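(* Let $K$ be an algebraically closed field of characteristic zero. There are canonical isomorphisms of groups $$\operatorname{Aut}(\mathbb A^n)\xrightarrow{\ \sim\ }\operatorname{Aut}_{\mathrm{Lie}}(\operatorname{Vec}(\mathbb A^n))\xrightarrow{\ \sim\ }\operatorname{Aut}_{\mathrm{Lie}}(\operatorname{Vec}^c(\mathbb A^n))\xrightarrow{\ \sim\ }\operatorname{Aut}_{\mathrm{Lie}}(\operatorname{Vec}^0(\mathbb A^n)),$$ where the first map is $\varphi\mapsto\operatorname{Ad}(\varphi)$, with $\operatorname{Ad}(\varphi)\delta:=(\varphi^* )^{-1}\circ\delta\circ\varphi^*$, and the second and third maps are given by restricting automorphisms to the Lie subalgebras $\operatorname{Vec}^c(\mathbb A^n)\subset\operatorname{Vec}(\mathbb A^n)$ and $\operatorname{Vec}^0(\mathbb A^n)\subset\operatorname{Vec}^c(\mathbb A^n)$, respectively.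
   Context: $\mathbb A^n=K^n$ is affine $n$-space over $K$, with coordinate ring $K[x_1,\dots,x_n]$. $\operatorname{Aut}(\mathbb A^n)$ is the group of polynomial automorphisms of $\mathbb A^n$; for $\varphi\in\operatorname{Aut}(\mathbb A^n)$ the comorphism $\varphi^*\colon K[x_1,\dots,x_n]\to K[x_1,\dots,x_n]$ is $f\mapsto f\circ\varphi$. $\operatorname{Vec}(\mathbb A^n)=\operatorname{Der}(K[x_1,\dots,x_n])=\{\sum_i f_i\,\partial/\partial x_i \mid f_i\in K[x_1,\dots,x_n]\}$ is the Lie algebra (over $K$) of polynomial vector fields on $\mathbb A^n$, with the commutator bracket. The divergence of $\delta=\sum_i f_i\,\partial/\partial x_i$ is $\operatorname{Div}\delta=\sum_i\partial f_i/\partial x_i$. The Lie subalgebras $\operatorname{Vec}^0(\mathbb A^n)\subset\operatorname{Vec}^c(\mathbb A^n)\subset\operatorname{Vec}(\mathbb A^n)$ are $$\operatorname{Vec}^0(\mathbb A^n)=\{\delta \mid \operatorname{Div}\delta=0\},\qquad \operatorname{Vec}^c(\mathbb A^n)=\{\delta\mid \operatorname{Div}\delta\in K\}.$$ For a Lie algebra $\mathfrak g$ over $K$, $\operatorname{Aut}_{\mathrm{Lie}}(\mathfrak g)$ is the group of Lie algebra automorphisms of $\mathfrak g$.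
   Formalization: The third isomorphism (restriction from Vec^c to Vec^0) is asserted only for n ≥ 2, since it fails for n = 1, where ∂ ↦ ∂, x∂ ↦ x∂ + ∂ restricts to the identity; the first two are proved for all n ≥ 1. *)

theory Defs
  imports
    "HOL-Algebra.Bij"
    "HOL-Analysis.Finite_Cartesian_Product"
    "HOL-Computational_Algebra.Polynomial"
    "HOL-Library.Poly_Mapping"
begin

section \<open>The coordinate ring\<close>

text \<open>
  The variables are indexed by a finite type \<open>'n\<close>, so that \<open>n = CARD('n)\<close>. An exponent
  vector is of type \<open>'n \<Rightarrow>\<^sub>0 nat\<close>, and the product on \<open>('n \<Rightarrow>\<^sub>0 nat) \<Rightarrow>\<^sub>0 'k\<close> is convolution,
  so this type is the polynomial ring over \<open>'k\<close> in the variables \<open>'n\<close>.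
\<close>

type_synonym ('k, 'n) mpoly = "('n \<Rightarrow>\<^sub>0 nat) \<Rightarrow>\<^sub>0 'k"

definition const :: "'k::comm_ring_1 \<Rightarrow> ('k, 'n) mpoly"
  where "const c = Poly_Mapping.single 0 c"

definition var :: "'n \<Rightarrow> ('k::comm_ring_1, 'n) mpoly"
  where "var i = Poly_Mapping.single (Poly_Mapping.single i 1) 1"

definition eval :: "('k::comm_ring_1, 'n::finite) mpoly \<Rightarrow> 'k ^ 'n \<Rightarrow> 'k"
  where "eval p x =
    (\<Sum>m\<in>Poly_Mapping.keys p. Poly_Mapping.lookup p m * (\<Prod>i\<in>UNIV. (x $ i) ^ Poly_Mapping.lookup m i))"

text \<open>
  The exponent subtraction is truncated, but the coefficient vanishes where this matters.
\<close>

definition partial :: "'n \<Rightarrow> ('k::comm_ring_1, 'n) mpoly \<Rightarrow> ('k, 'n) mpoly"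
  where "partial i p =
    (\<Sum>m\<in>Poly_Mapping.keys p.
      Poly_Mapping.single (m - Poly_Mapping.single i 1)
        (of_nat (Poly_Mapping.lookup m i) * Poly_Mapping.lookup p m))"


section \<open>Polynomial automorphisms of affine space\<close>

definition polynomial_map :: "('k::comm_ring_1 ^ 'n::finite \<Rightarrow> 'k ^ 'n) \<Rightarrow> bool"
  where "polynomial_map \<phi> \<longleftrightarrow> (\<exists>F :: 'n \<Rightarrow> ('k, 'n) mpoly. \<forall>x i. \<phi> x $ i = eval (F i) x)"

definition Aut_affine :: "('k::comm_ring_1 ^ 'n::finite \<Rightarrow> 'k ^ 'n) monoid"
  where "Aut_affine = BijGroup UNIV
    \<lparr>carrier := {\<phi>. bij \<phi> \<and> polynomial_map \<phi> \<and> polynomial_map (inv_into UNIV \<phi>)}\<rparr>"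

text \<open>
  The polynomial below exists if \<open>\<phi>\<close> is a polynomial map, and it is unique if \<open>'k\<close> is an
  infinite field; see \<open>comorphism_unique_exists\<close>.
\<close>

definition comorphism ::
    "('k::comm_ring_1 ^ 'n::finite \<Rightarrow> 'k ^ 'n) \<Rightarrow> ('k, 'n) mpoly \<Rightarrow> ('k, 'n) mpoly"
  where "comorphism \<phi> f = (THE g. eval g = eval f \<circ> \<phi>)"


section \<open>Polynomial vector fields\<close>

type_synonym ('k, 'n) operator = "('k, 'n) mpoly \<Rightarrow> ('k, 'n) mpoly"

definition Vec :: "('k::comm_ring_1, 'n) operator set"
  where "Vec = {\<delta>. (\<forall>f g. \<delta> (f + g) = \<delta> f + \<delta> g) \<and> (\<forall>c f. \<delta> (const c * f) = const c * \<delta> f) \<and>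
                   (\<forall>f g. \<delta> (f * g) = \<delta> f * g + f * \<delta> g)}"

definition vector_field :: "('n::finite \<Rightarrow> ('k::comm_ring_1, 'n) mpoly) \<Rightarrow> ('k, 'n) operator"
  where "vector_field F = (\<lambda>p. \<Sum>i\<in>UNIV. F i * partial i p)"

text \<open>
  The coefficient of \<open>\<partial>/\<partial>x\<^sub>i\<close> in a derivation \<open>\<delta>\<close> is \<open>\<delta> x\<^sub>i\<close>; see \<open>Vec_eq\<close> and
  \<open>divergence_vector_field\<close>.
\<close>

definition divergence :: "('k::comm_ring_1, 'n::finite) operator \<Rightarrow> ('k, 'n) mpoly"
  where "divergence \<delta> = (\<Sum>i\<in>UNIV. partial i (\<delta> (var i)))"

definition Vec_const_div :: "('k::comm_ring_1, 'n::finite) operator set"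
  where "Vec_const_div = {\<delta> \<in> Vec. divergence \<delta> \<in> range const}"

definition Vec_zero_div :: "('k::comm_ring_1, 'n::finite) operator set"
  where "Vec_zero_div = {\<delta> \<in> Vec. divergence \<delta> = 0}"


section \<open>Lie algebras of operators and their automorphisms\<close>

definition add_op :: "('k::comm_ring_1, 'n) operator \<Rightarrow> ('k, 'n) operator \<Rightarrow> ('k, 'n) operator"
  where "add_op \<delta> \<epsilon> = (\<lambda>p. \<delta> p + \<epsilon> p)"

definition scale_op :: "'k::comm_ring_1 \<Rightarrow> ('k, 'n) operator \<Rightarrow> ('k, 'n) operator"
  where "scale_op c \<delta> = (\<lambda>p. const c * \<delta> p)"

definition lie_bracket ::
    "('k::comm_ring_1, 'n) operator \<Rightarrow> ('k, 'n) operator \<Rightarrow> ('k, 'n) operator"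
  where "lie_bracket \<delta> \<epsilon> = (\<lambda>p. \<delta> (\<epsilon> p) - \<epsilon> (\<delta> p))"

definition lie_subalgebra :: "('k::comm_ring_1, 'n) operator set \<Rightarrow> bool"
  where "lie_subalgebra \<gg> \<longleftrightarrow> (\<lambda>p. 0) \<in> \<gg> \<and>
    (\<forall>\<delta>\<in>\<gg>. \<forall>\<epsilon>\<in>\<gg>. add_op \<delta> \<epsilon> \<in> \<gg> \<and> lie_bracket \<delta> \<epsilon> \<in> \<gg>) \<and>
    (\<forall>c. \<forall>\<delta>\<in>\<gg>. scale_op c \<delta> \<in> \<gg>)"

text \<open>
  As in \<^const>\<open>BijGroup\<close>, an automorphism of \<open>\<gg>\<close> is a function that is undefined outside
  of \<open>\<gg>\<close>.
\<close>

definition lie_auto :: "('k::comm_ring_1, 'n) operator set \<Rightarrow>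
    (('k, 'n) operator \<Rightarrow> ('k, 'n) operator) set"
  where "lie_auto \<gg> = {\<theta> \<in> Bij \<gg>.
    (\<forall>\<delta>\<in>\<gg>. \<forall>\<epsilon>\<in>\<gg>. \<theta> (add_op \<delta> \<epsilon>) = add_op (\<theta> \<delta>) (\<theta> \<epsilon>)) \<and>
    (\<forall>c. \<forall>\<delta>\<in>\<gg>. \<theta> (scale_op c \<delta>) = scale_op c (\<theta> \<delta>)) \<and>
    (\<forall>\<delta>\<in>\<gg>. \<forall>\<epsilon>\<in>\<gg>. \<theta> (lie_bracket \<delta> \<epsilon>) = lie_bracket (\<theta> \<delta>) (\<theta> \<epsilon>))}"

definition Aut_Lie :: "('k::comm_ring_1, 'n) operator set \<Rightarrow>
    (('k, 'n) operator \<Rightarrow> ('k, 'n) operator) monoid"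
  where "Aut_Lie \<gg> = BijGroup \<gg> \<lparr>carrier := lie_auto \<gg>\<rparr>"

definition Ad :: "('k::comm_ring_1 ^ 'n::finite \<Rightarrow> 'k ^ 'n) \<Rightarrow>
    ('k, 'n) operator \<Rightarrow> ('k, 'n) operator"
  where "Ad \<phi> = (\<lambda>\<delta>\<in>Vec. inv_into UNIV (comorphism \<phi>) \<circ> \<delta> \<circ> comorphism \<phi>)"


text \<open>
  If \<open>n = 1\<close>, then restriction of automorphisms from \<^const>\<open>Vec_const_div\<close> to
  \<^const>\<open>Vec_zero_div\<close> is not injective: the former is spanned by \<open>\<partial>/\<partial>x\<close> and \<open>x \<partial>/\<partial>x\<close>, the
  latter by \<open>\<partial>/\<partial>x\<close> alone, and the automorphism with \<open>\<partial>/\<partial>x \<mapsto> \<partial>/\<partial>x\<close> and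
  \<open>x \<partial>/\<partial>x \<mapsto> x \<partial>/\<partial>x + \<partial>/\<partial>x\<close> restricts to the identity.
\<close>


section \<open>Consistency of the definitions\<close>

subsection \<open>Polynomials\<close>

lemma mpoly_expand: "(p :: ('k::comm_ring_1, 'n) mpoly) =
    (\<Sum>m\<in>Poly_Mapping.keys p. Poly_Mapping.single m (Poly_Mapping.lookup p m))"
  by (rule poly_mapping_eqI)
    (simp add: lookup_sum lookup_single when_def in_keys_iff)

lemma mpoly_add_induct:
  assumes "P 0" and "\<And>m a. P (Poly_Mapping.single m a)" and "\<And>p q. P p \<Longrightarrow> P q \<Longrightarrow> P (p + q)"
  shows "P (p :: ('k::comm_ring_1, 'n) mpoly)"
proof -
  have "P (\<Sum>m\<in>A. Poly_Mapping.single m (Poly_Mapping.lookup p m))" if "finite A" for A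
    using that by (induction A) (auto intro: assms)
  then show ?thesis
    using mpoly_expand[of p] by (metis finite_keys)
qed

lemma single_eq_var_mult:
  fixes m :: "'n::finite \<Rightarrow>\<^sub>0 nat"
  assumes "Poly_Mapping.lookup m i > 0"
  shows "Poly_Mapping.single m a = var i * Poly_Mapping.single (m - Poly_Mapping.single i 1) a"
proof -
  have "Poly_Mapping.single i 1 + (m - Poly_Mapping.single i 1) = m"
    by (rule poly_mapping_eqI) (use assms in \<open>auto simp: lookup_add lookup_minus lookup_single when_def\<close>)
  then show ?thesis
    by (simp add: var_def mult_single)
qed

lemma mpoly_induct [case_names const var add]:
  assumes const: "\<And>c. P (const c)" and var: "\<And>i q. P q \<Longrightarrow> P (var i * q)"
    and add: "\<And>p q. P p \<Longrightarrow> P q \<Longrightarrow> P (p + q)"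
  shows "P (p :: ('k::comm_ring_1, 'n::finite) mpoly)"
proof -
  have single: "P (Poly_Mapping.single m a)" for m a
  proof (induction "\<Sum>i\<in>UNIV. Poly_Mapping.lookup m i" arbitrary: m rule: less_induct)
    case less
    show ?case
    proof (cases "m = 0")
      case True
      then show ?thesis
        using const[of a] by (simp add: const_def)
    next
      case False
      then obtain i where i: "Poly_Mapping.lookup m i > 0"
        by (metis gr0I lookup_zero poly_mapping_eqI)
      have "(\<Sum>j\<in>UNIV. Poly_Mapping.lookup (m - Poly_Mapping.single i 1) j)
          < (\<Sum>j\<in>UNIV. Poly_Mapping.lookup m j)"
        by (rule sum_strict_mono_ex1) (use i in \<open>auto simp: lookup_minus lookup_single when_def\<close>)
      then show ?thesis
        using less single_eq_var_mult[OF i] var by metis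
    qed
  qed
  show ?thesis
    by (rule mpoly_add_induct) (use const[of 0] single add in \<open>auto simp: const_def\<close>)
qed

lemma eval_superset:
  assumes "finite A" "Poly_Mapping.keys p \<subseteq> A"
  shows "eval p x =
    (\<Sum>m\<in>A. Poly_Mapping.lookup p m * (\<Prod>i\<in>UNIV. (x $ i) ^ Poly_Mapping.lookup m i))"
  unfolding eval_def by (rule sum.mono_neutral_left) (use assms in \<open>auto simp: in_keys_iff\<close>)

lemma eval_zero [simp]: "eval 0 x = 0"
  by (simp add: eval_def)

lemma eval_add [simp]: "eval (p + q) x = eval p x + eval q x"
proof -
  let ?A = "Poly_Mapping.keys p \<union> Poly_Mapping.keys q"
  have "Poly_Mapping.keys (p + q) \<subseteq> ?A"
    by (rule keys_add)
  then show ?thesis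
    by (subst (1 2 3) eval_superset[of ?A]) (auto simp: lookup_add distrib_right sum.distrib)
qed

lemma eval_sum [simp]: "eval (\<Sum>a\<in>A. f a) x = (\<Sum>a\<in>A. eval (f a) x)"
  by (induction A rule: infinite_finite_induct) auto

lemma eval_minus [simp]: "eval (p - q) x = eval p x - eval q x"
  using eval_add[of "p - q" q x] by simp

lemma eval_single:
  "eval (Poly_Mapping.single m a) x = a * (\<Prod>i\<in>UNIV. (x $ i) ^ Poly_Mapping.lookup m i)"
  by (simp add: eval_def)

lemma eval_mult [simp]: "eval (p * q) x = eval p x * eval q x"
proof (induction p rule: mpoly_add_induct)
  case (2 m a)
  show ?case
    by (induction q rule: mpoly_add_induct)
      (auto simp: mult_single eval_single lookup_add power_add prod.distrib algebra_simps)
qed (auto simp: distrib_right)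

lemma eval_const [simp]: "eval (const c) x = c"
  by (simp add: const_def eval_single)

lemma eval_var [simp]: "eval (var i) x = x $ i"
proof -
  have "(\<Prod>j\<in>UNIV. (x $ j) ^ Poly_Mapping.lookup (Poly_Mapping.single i 1) j)
      = (\<Prod>j\<in>UNIV. if j = i then x $ i else 1)"
    by (rule prod.cong) (auto simp: lookup_single when_def)
  then show ?thesis
    by (simp add: var_def eval_single)
qed

lemma eval_eq_0_imp:
  fixes p :: "('k::field_char_0, 'n::finite) mpoly"
  assumes "finite S" "\<forall>m\<in>Poly_Mapping.keys p. \<forall>i. i \<notin> S \<longrightarrow> Poly_Mapping.lookup m i = 0"
    and "\<forall>x. eval p x = 0"
  shows "p = 0"
  using assms
proof (induction S arbitrary: p rule: finite_induct)
  case empty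
  have "Poly_Mapping.keys p \<subseteq> {0}"
    using empty.prems(1) by (auto intro: poly_mapping_eqI)
  then have "eval p x = Poly_Mapping.lookup p 0" for x
    by (subst eval_superset[of "{0}"]) auto
  then have "Poly_Mapping.lookup p 0 = 0"
    using empty.prems(2) by simp
  then show ?case
    using \<open>Poly_Mapping.keys p \<subseteq> {0}\<close> by (metis in_keys_iff keys_eq_empty subset_singletonD singletonI)
next
  case (insert j S)
  let ?K = "Poly_Mapping.keys p"
  let ?e = "\<lambda>d. Poly_Mapping.single j d :: 'n \<Rightarrow>\<^sub>0 nat"
  define K where "K d = {m \<in> ?K. Poly_Mapping.lookup m j = d}" for d
  define c where "c d = (\<Sum>m\<in>K d. Poly_Mapping.single (m - ?e d) (Poly_Mapping.lookup p m))" for d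
  define D where "D = (\<lambda>m. Poly_Mapping.lookup m j) ` ?K"
  have fin: "finite D" "finite (K d)" for d
    by (auto simp: D_def K_def)
  have mem: "Poly_Mapping.lookup m' i = (if i = j then 0 else Poly_Mapping.lookup m i)"
    if "m \<in> K d" "m' = m - ?e d" for m m' d i
    using that by (auto simp: K_def lookup_minus lookup_single when_def)
  have inj: "inj_on (\<lambda>m. m - ?e d) (K d)" for d
  proof (rule inj_onI)
    fix m m' assume mm: "m \<in> K d" "m' \<in> K d" "m - ?e d = m' - ?e d"
    show "m = m'"
    proof (rule poly_mapping_eqI)
      fix i
      show "Poly_Mapping.lookup m i = Poly_Mapping.lookup m' i"
        using mem[OF mm(1) refl, of i] mem[OF mm(2) refl, of i] mm by (auto simp: K_def split: if_splits)
    qed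
  qed
  have lookup_c: "Poly_Mapping.lookup (c d) (m - ?e d) = Poly_Mapping.lookup p m" if "m \<in> K d" for m d
  proof -
    have "Poly_Mapping.lookup (c d) (m - ?e d) =
        (\<Sum>m'\<in>K d. if m' = m then Poly_Mapping.lookup p m else 0)"
      unfolding c_def lookup_sum
      by (rule sum.cong) (use inj_onD[OF inj _ _ that] in \<open>auto simp: lookup_single when_def\<close>)
    then show ?thesis
      using that fin by simp
  qed
  have eval_c: "eval (c d) x =
      (\<Sum>m\<in>K d. Poly_Mapping.lookup p m * (\<Prod>i\<in>UNIV - {j}. (x $ i) ^ Poly_Mapping.lookup m i))" for d x
    unfolding c_def eval_sum eval_single
  proof (rule sum.cong, goal_cases)
    case (2 m)
    have "(\<Prod>i\<in>UNIV. (x $ i) ^ Poly_Mapping.lookup (m - ?e d) i) =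
        (\<Prod>i\<in>UNIV - {j}. (x $ i) ^ Poly_Mapping.lookup (m - ?e d) i)"
      using mem[OF 2 refl] by (simp add: prod.remove[of _ j])
    also have "\<dots> = (\<Prod>i\<in>UNIV - {j}. (x $ i) ^ Poly_Mapping.lookup m i)"
      by (rule prod.cong) (use mem[OF 2 refl] in auto)
    finally show ?case
      by simp
  qed simp
  have eval_p: "eval p x = (\<Sum>d\<in>D. eval (c d) x * (x $ j) ^ d)" for x
  proof -
    have "eval p x = (\<Sum>d\<in>D. \<Sum>m\<in>K d.
        Poly_Mapping.lookup p m * (\<Prod>i\<in>UNIV. (x $ i) ^ Poly_Mapping.lookup m i))"
      unfolding eval_def K_def D_def by (subst sum.image_gen[where g = "\<lambda>m. Poly_Mapping.lookup m j"]) auto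
    also have "\<dots> = (\<Sum>d\<in>D. eval (c d) x * (x $ j) ^ d)"
      unfolding eval_c sum_distrib_right
      by (intro sum.cong refl) (auto simp: K_def prod.remove[of UNIV j])
    finally show ?thesis .
  qed
  have eval_c_0: "eval (c d) x = 0" if "d \<in> D" for d x
  proof -
    define q where "q = (\<Sum>d\<in>D. Polynomial.monom (eval (c d) x) d)"
    have "poly q t = 0" for t
    proof -
      let ?y = "\<chi> i. if i = j then t else x $ i"
      have "eval (c d) ?y = eval (c d) x" for d
        unfolding eval_c by (auto intro!: sum.cong prod.cong)
      then have "eval p ?y = poly q t"
        by (simp add: eval_p q_def poly_sum poly_monom)
      then show ?thesis
        using insert.prems(2) by simp
    qed
    then have "q = 0"
      using poly_all_0_iff_0 by blast
    moreover have "poly.coeff q d = eval (c d) x"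
      using that fin by (simp add: q_def coeff_sum)
    ultimately show ?thesis
      by simp
  qed
  have c_0: "c d = 0" if "d \<in> D" for d
  proof (rule insert.IH)
    show "\<forall>m\<in>Poly_Mapping.keys (c d). \<forall>i. i \<notin> S \<longrightarrow> Poly_Mapping.lookup m i = 0"
    proof (intro ballI allI impI)
      fix m' i assume "m' \<in> Poly_Mapping.keys (c d)" "i \<notin> S"
      then obtain m where "m \<in> K d" "m' = m - ?e d"
        using keys_sum[of "\<lambda>m. Poly_Mapping.single (m - ?e d) (Poly_Mapping.lookup p m)" "K d"]
        by (auto simp: c_def split: if_splits)
      then show "Poly_Mapping.lookup m' i = 0"
        using mem[of m d m' i] insert.prems(1) \<open>i \<notin> S\<close> by (auto simp: K_def)
    qed
  qed (use that eval_c_0 in auto)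
  have "Poly_Mapping.lookup p m = 0" if "m \<in> ?K" for m
    using lookup_c[of m "Poly_Mapping.lookup m j"] c_0[of "Poly_Mapping.lookup m j"] that
    by (auto simp: K_def D_def)
  then show ?case
    by (intro poly_mapping_eqI) (metis in_keys_iff lookup_zero)
qed

lemma eval_inject: "eval p = eval q \<longleftrightarrow> p = (q :: ('k::field_char_0, 'n::finite) mpoly)"
proof
  assume "eval p = eval q"
  then have "p - q = 0"
    by (intro eval_eq_0_imp[of UNIV]) auto
  then show "p = q"
    by simp
qed simp

lemma comorphism_unique_exists:
  fixes f :: "('k::field_char_0, 'n::finite) mpoly"
  assumes "polynomial_map \<phi>"
  shows "\<exists>!g. eval g = eval f \<circ> \<phi>"
proof -
  obtain F :: "'n \<Rightarrow> ('k, 'n) mpoly" where F: "\<And>x i. \<phi> x $ i = eval (F i) x"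
    using assms unfolding polynomial_map_def by blast
  have "\<exists>g. \<forall>x. eval g x = eval f (\<phi> x)"
  proof (induction f rule: mpoly_induct)
    case (const c)
    show ?case
      by (rule exI[of _ "const c"]) simp
  next
    case (var i q)
    then obtain g where "\<forall>x. eval g x = eval q (\<phi> x)" by blast
    then show ?case
      by (intro exI[of _ "F i * g"]) (simp add: F)
  next
    case (add p q)
    then show ?case
      by (metis eval_add)
  qed
  then show ?thesis
    by (auto simp: fun_eq_iff simp flip: eval_inject)
qed

lemma eval_comorphism:
  fixes f :: "('k::field_char_0, 'n::finite) mpoly"
  assumes "polynomial_map \<phi>"
  shows "eval (comorphism \<phi> f) = eval f \<circ> \<phi>"
  unfolding comorphism_def using theI'[OF comorphism_unique_exists[OF assms]] .


subsection \<open>Derivations\<close>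

lemma lookup_partial:
  "Poly_Mapping.lookup (partial i p) m =
    of_nat (Suc (Poly_Mapping.lookup m i)) * Poly_Mapping.lookup p (m + Poly_Mapping.single i 1)"
proof -
  let ?m = "m + Poly_Mapping.single i 1"
  have iff: "m' - Poly_Mapping.single i 1 = m \<longleftrightarrow> m' = ?m" if "Poly_Mapping.lookup m' i \<noteq> 0" for m'
  proof
    assume *: "m' - Poly_Mapping.single i 1 = m"
    show "m' = ?m"
      unfolding *[symmetric]
      by (rule poly_mapping_eqI) (use that in \<open>auto simp: lookup_add lookup_minus lookup_single when_def\<close>)
  qed simp
  have "Poly_Mapping.lookup (partial i p) m =
    (\<Sum>m'\<in>Poly_Mapping.keys p. if m' = ?m
       then of_nat (Suc (Poly_Mapping.lookup m i)) * Poly_Mapping.lookup p ?m else 0)"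
    unfolding partial_def lookup_sum
  proof (rule sum.cong, goal_cases)
    case (2 m')
    then show ?case
      using iff[of m'] by (cases "Poly_Mapping.lookup m' i = 0") (auto simp: lookup_single when_def lookup_add)
  qed simp
  then show ?thesis
    by (auto simp: in_keys_iff)
qed

lemma partial_add [simp]: "partial i (p + q) = partial i p + partial i q"
  by (rule poly_mapping_eqI) (simp add: lookup_partial lookup_add distrib_left)

lemma partial_zero [simp]: "partial i 0 = 0"
  by (simp add: partial_def)

lemma partial_minus [simp]: "partial i (p - q) = partial i p - partial i q"
  using partial_add[of i "p - q" q] by (simp add: algebra_simps)

lemma partial_sum [simp]: "partial i (\<Sum>a\<in>A. f a) = (\<Sum>a\<in>A. partial i (f a))"
  by (induction A rule: infinite_finite_induct) auto

lemma partial_single: "partial i (Poly_Mapping.single m a) =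
    Poly_Mapping.single (m - Poly_Mapping.single i 1) (of_nat (Poly_Mapping.lookup m i) * a)"
  by (cases "a = 0") (auto simp: partial_def)

lemma partial_mult [simp]: "partial i (p * q) = partial i p * q + p * partial i q"
proof (induction p rule: mpoly_add_induct)
  case (2 m a)
  show ?case
  proof (induction q rule: mpoly_add_induct)
    case (2 l b)
    let ?e = "Poly_Mapping.single i (1::nat)"
    have *: "m - ?e + l = m + l - ?e" if "Poly_Mapping.lookup m i \<noteq> 0" for m l
      by (rule poly_mapping_eqI) (use that in \<open>auto simp: lookup_add lookup_minus lookup_single when_def\<close>)
    have m: "Poly_Mapping.single (m - ?e + l) (of_nat (Poly_Mapping.lookup m i) * a * b) =
        Poly_Mapping.single (m + l - ?e) (of_nat (Poly_Mapping.lookup m i) * a * b)"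
      using *[of m l] by (cases "Poly_Mapping.lookup m i = 0") auto
    have l: "Poly_Mapping.single (m + (l - ?e)) (a * (of_nat (Poly_Mapping.lookup l i) * b)) =
        Poly_Mapping.single (m + l - ?e) (a * (of_nat (Poly_Mapping.lookup l i) * b))"
      using *[of l m] by (cases "Poly_Mapping.lookup l i = 0") (auto simp: add.commute)
    show ?case
      unfolding partial_single mult_single m l
      by (simp add: lookup_add algebra_simps flip: single_add)
  qed (auto simp: algebra_simps)
qed (auto simp: algebra_simps)

lemma partial_const [simp]: "partial i (const c) = 0"
  by (simp add: const_def partial_single)

lemma partial_var: "partial i (var j) = (if i = j then 1 else 0)"
  by (auto simp: var_def partial_single lookup_single when_def)

lemma vector_field_var [simp]: "vector_field F (var i) = F i"
  by (simp add: vector_field_def partial_var if_distrib[of "\<lambda>x. _ * x"] cong: if_cong)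

lemma vector_field_mult: "vector_field F (p * q) = vector_field F p * q + p * vector_field F q"
  by (simp add: vector_field_def algebra_simps sum.distrib sum_distrib_left)

lemma Vec_eq: "Vec = range (vector_field :: ('n::finite \<Rightarrow> ('k::comm_ring_1, 'n) mpoly) \<Rightarrow> _)"
proof (intro Set.set_eqI iffI)
  fix \<delta> :: "('k, 'n) operator"
  assume "\<delta> \<in> Vec"
  then have add: "\<And>f g. \<delta> (f + g) = \<delta> f + \<delta> g" and scale: "\<And>c f. \<delta> (const c * f) = const c * \<delta> f"
    and mult: "\<And>f g. \<delta> (f * g) = \<delta> f * g + f * \<delta> g"
    by (auto simp: Vec_def)
  have one: "\<delta> 1 = 0"
    using mult[of 1 1] by simp
  have "\<delta> p = vector_field (\<lambda>i. \<delta> (var i)) p" for p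
  proof (induction p rule: mpoly_induct)
    case (const c)
    show ?case
      using scale[of c 1] one by (simp add: vector_field_def)
  next
    case (var i q)
    then show ?case
      by (simp add: mult vector_field_mult)
  next
    case (add p q)
    then show ?case
      by (simp add: \<open>\<And>f g. \<delta> (f + g) = \<delta> f + \<delta> g\<close> vector_field_def distrib_left sum.distrib)
  qed
  then have "\<delta> = vector_field (\<lambda>i. \<delta> (var i))"
    by blast
  then show "\<delta> \<in> range vector_field"
    by (metis rangeI)
next
  fix \<delta> :: "('k, 'n) operator"
  assume "\<delta> \<in> range vector_field"
  then show "\<delta> \<in> Vec"
    by (auto simp: Vec_def vector_field_def algebra_simps sum.distrib sum_distrib_left)
qed

lemma divergence_vector_field: "divergence (vector_field F) = (\<Sum>i\<in>UNIV. partial i (F i))"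
  by (simp add: divergence_def)


subsection \<open>Lie subalgebras\<close>

lemma const_diff: "const a - const b = const (a - b)"
  by (simp add: const_def single_diff)

lemma partial_commute: "partial i (partial j p) = partial j (partial i p)"
  by (rule poly_mapping_eqI) (auto simp: lookup_partial lookup_add lookup_single when_def add_ac mult_ac)

lemma VecD:
  assumes "\<delta> \<in> Vec"
  shows "\<delta> (f + g) = \<delta> f + \<delta> g" "\<delta> (const c * f) = const c * \<delta> f"
    "\<delta> (f * g) = \<delta> f * g + f * \<delta> g" "\<delta> 0 = 0" "\<delta> (f - g) = \<delta> f - \<delta> g" "\<delta> (const c) = 0"
proof -
  have add: "\<delta> (f + g) = \<delta> f + \<delta> g" and scale: "\<delta> (const c * f) = const c * \<delta> f"
    and mult: "\<delta> (f * g) = \<delta> f * g + f * \<delta> g" for c f g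
    using assms unfolding Vec_def by blast+
  show "\<delta> (f + g) = \<delta> f + \<delta> g" "\<delta> (const c * f) = const c * \<delta> f"
    "\<delta> (f * g) = \<delta> f * g + f * \<delta> g"
    by (fact add scale mult)+
  show "\<delta> 0 = 0" using add[of 0 0] by simp
  show "\<delta> (f - g) = \<delta> f - \<delta> g" using add[of "f - g" g] by (simp add: algebra_simps)
  show "\<delta> (const c) = 0" using scale[of c 1] mult[of 1 1] by simp
qed

lemma divergence_add_op: "divergence (add_op \<delta> \<epsilon>) = divergence \<delta> + divergence \<epsilon>"
  by (simp add: divergence_def add_op_def sum.distrib)

lemma divergence_scale_op: "divergence (scale_op c \<delta>) = const c * divergence \<delta>"
  by (simp add: divergence_def scale_op_def sum_distrib_left)

lemma divergence_lie_bracket: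
  fixes \<delta> \<epsilon> :: "('k::comm_ring_1, 'n::finite) operator"
  assumes "\<delta> \<in> Vec" "\<epsilon> \<in> Vec"
  shows "divergence (lie_bracket \<delta> \<epsilon>) = \<delta> (divergence \<epsilon>) - \<epsilon> (divergence \<delta>)"
proof -
  obtain F G where F: "\<delta> = vector_field F" and G: "\<epsilon> = vector_field G"
    using assms by (auto simp: Vec_eq)
  have *: "(\<Sum>i\<in>UNIV. partial i (vector_field A (B i))) =
      (\<Sum>i\<in>UNIV. \<Sum>j\<in>UNIV. partial i (A j) * partial j (B i)) +
      vector_field A (\<Sum>i\<in>UNIV. partial i (B i))" for A B :: "'n \<Rightarrow> ('k, 'n) mpoly"
  proof -
    have "(\<Sum>i\<in>UNIV. \<Sum>j\<in>UNIV. A j * partial i (partial j (B i))) =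
        vector_field A (\<Sum>i\<in>UNIV. partial i (B i))"
      unfolding vector_field_def partial_sum sum_distrib_left
      by (subst sum.swap) (simp add: partial_commute)
    then show ?thesis
      by (simp add: vector_field_def sum.distrib)
  qed
  have "(\<Sum>i\<in>UNIV. \<Sum>j\<in>UNIV. partial i (F j) * partial j (G i)) =
      (\<Sum>i\<in>UNIV. \<Sum>j\<in>UNIV. partial i (G j) * partial j (F i))"
    by (subst sum.swap) (simp add: mult.commute)
  then show ?thesis
    using *[of F G] *[of G F]
    by (simp add: divergence_def lie_bracket_def F G sum_subtractf)
qed

lemma lie_subalgebra_Vec: "lie_subalgebra (Vec :: ('k::comm_ring_1, 'n) operator set)"
  unfolding lie_subalgebra_def
proof (intro conjI ballI allI)
  fix \<delta> \<epsilon> :: "('k, 'n) operator" and c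
  assume d: "\<delta> \<in> Vec"
  show "scale_op c \<delta> \<in> Vec"
    unfolding Vec_def by (auto simp: scale_op_def VecD[OF d] algebra_simps)
  assume e: "\<epsilon> \<in> Vec"
  show "add_op \<delta> \<epsilon> \<in> Vec"
    unfolding Vec_def by (auto simp: add_op_def VecD[OF d] VecD[OF e] algebra_simps)
  show "lie_bracket \<delta> \<epsilon> \<in> Vec"
    unfolding Vec_def
    by (auto simp: lie_bracket_def VecD(1-3)[OF d] VecD(1-3)[OF e] VecD(6)[OF d] VecD(6)[OF e] algebra_simps)
qed (simp add: Vec_def)

lemma lie_subalgebra_Vec_zero_div:
  "lie_subalgebra (Vec_zero_div :: ('k::comm_ring_1, 'n::finite) operator set)"
proof -
  have "divergence (\<lambda>p. 0 :: ('k, 'n) mpoly) = 0"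
    by (simp add: divergence_def)
  with lie_subalgebra_Vec[where 'k = 'k and 'n = 'n] show ?thesis
    by (auto simp: lie_subalgebra_def Vec_zero_div_def divergence_add_op divergence_scale_op
        divergence_lie_bracket VecD)
qed

lemma lie_subalgebra_Vec_const_div:
  "lie_subalgebra (Vec_const_div :: ('k::comm_ring_1, 'n::finite) operator set)"
proof -
  have const: "(0 :: ('k, 'n) mpoly) = const 0" "const a + const b = const (a + b)"
    "const a * const b = const (a * b)" for a b :: 'k
    by (simp_all add: const_def single_add mult_single)
  have "divergence (\<lambda>p. 0 :: ('k, 'n) mpoly) = 0"
    by (simp add: divergence_def)
  with lie_subalgebra_Vec[where 'k = 'k and 'n = 'n] show ?thesis
    by (auto simp: lie_subalgebra_def Vec_const_div_def divergence_add_op divergence_scale_op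
        divergence_lie_bracket VecD const)
qed

lemma Vec_zero_div_subset: "Vec_zero_div \<subseteq> Vec_const_div" "Vec_const_div \<subseteq> Vec"
  by (auto simp: Vec_zero_div_def Vec_const_div_def const_def intro: range_eqI[of _ _ 0])


subsection \<open>Groups\<close>

lemma group_Aut_Lie:
  assumes "lie_subalgebra \<gg>"
  shows "group (Aut_Lie \<gg>)"
proof -
  note cl = assms[unfolded lie_subalgebra_def]
  have inv_mem: "restrict (inv_into \<gg> \<theta>) \<gg> \<in> lie_auto \<gg>" if "\<theta> \<in> lie_auto \<gg>" for \<theta>
  proof -
    have B: "\<theta> \<in> Bij \<gg>" using that by (simp add: lie_auto_def)
    then have bij: "bij_betw \<theta> \<gg> \<gg>" by (simp add: Bij_def)
    have 1: "\<And>x. x \<in> \<gg> \<Longrightarrow> inv_into \<gg> \<theta> x \<in> \<gg>" "\<And>x. x \<in> \<gg> \<Longrightarrow> \<theta> (inv_into \<gg> \<theta> x) = x"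
      "\<And>x y. x \<in> \<gg> \<Longrightarrow> \<theta> x = y \<Longrightarrow> inv_into \<gg> \<theta> y = x"
      using bij by (auto simp: Bij_inv_into_mem[OF B] bij_betw_inv_into_right bij_betw_inv_into_left)
    show ?thesis
      using that cl 1 unfolding lie_auto_def
      by (auto intro!: restrict_inv_into_Bij[OF B] 1(3))
  qed
  have "subgroup (lie_auto \<gg>) (BijGroup \<gg>)"
  proof (rule subgroup.intro)
    show "lie_auto \<gg> \<subseteq> carrier (BijGroup \<gg>)"
      by (auto simp: BijGroup_def lie_auto_def)
    show "\<one>\<^bsub>BijGroup \<gg>\<^esub> \<in> lie_auto \<gg>"
      using cl by (auto simp: BijGroup_def lie_auto_def id_Bij)
  next
    fix x y assume xy: "x \<in> lie_auto \<gg>" "y \<in> lie_auto \<gg>"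
    then have B: "x \<in> Bij \<gg>" "y \<in> Bij \<gg>" by (auto simp: lie_auto_def)
    have "y \<delta> \<in> \<gg>" if "\<delta> \<in> \<gg>" for \<delta>
      using Bij_imp_funcset[OF B(2)] that by auto
    then show "x \<otimes>\<^bsub>BijGroup \<gg>\<^esub> y \<in> lie_auto \<gg>"
      using xy cl B by (auto simp: BijGroup_def lie_auto_def compose_Bij compose_eq)
  next
    fix x assume x: "x \<in> lie_auto \<gg>"
    then have "x \<in> Bij \<gg>" by (simp add: lie_auto_def)
    then show "inv\<^bsub>BijGroup \<gg>\<^esub> x \<in> lie_auto \<gg>"
      using inv_mem[OF x] by (simp add: inv_BijGroup)
  qed
  then show ?thesis
    unfolding Aut_Lie_def by (rule subgroup.subgroup_is_group[OF _ group_BijGroup])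
qed

lemma polynomial_map_comp:
  fixes \<phi> \<psi> :: "'k::field_char_0 ^ 'n::finite \<Rightarrow> 'k ^ 'n"
  assumes "polynomial_map \<phi>" "polynomial_map \<psi>"
  shows "polynomial_map (\<phi> \<circ> \<psi>)"
proof -
  obtain F where F: "\<forall>x i. \<phi> x $ i = eval (F i) x"
    using assms(1) unfolding polynomial_map_def by blast
  have "\<forall>x i. (\<phi> \<circ> \<psi>) x $ i = eval (comorphism \<psi> (F i)) x"
    using F by (simp add: eval_comorphism[OF assms(2)])
  then show ?thesis
    unfolding polynomial_map_def by (rule exI[of _ "\<lambda>i. comorphism \<psi> (F i)"])
qed

lemma group_Aut_affine: "group (Aut_affine :: ('k::field_char_0 ^ 'n::finite \<Rightarrow> 'k ^ 'n) monoid)"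
proof -
  let ?A = "{\<phi> :: 'k ^ 'n \<Rightarrow> 'k ^ 'n.
    bij \<phi> \<and> polynomial_map \<phi> \<and> polynomial_map (inv_into UNIV \<phi>)}"
  have B: "Bij UNIV = {\<phi> :: 'k ^ 'n \<Rightarrow> 'k ^ 'n. bij \<phi>}"
    by (auto simp: Bij_def)
  have "subgroup ?A (BijGroup UNIV)"
  proof (rule subgroup.intro)
    show "?A \<subseteq> carrier (BijGroup UNIV)"
      by (auto simp: BijGroup_def B)
    have "polynomial_map (\<lambda>x :: 'k ^ 'n. x)"
      unfolding polynomial_map_def by (rule exI[of _ var]) simp
    moreover have "inv_into UNIV (\<lambda>x :: 'k ^ 'n. x) = (\<lambda>x. x)"
      by (rule Hilbert_Choice.inv_equality) auto
    moreover have "restrict (\<lambda>x :: 'k ^ 'n. x) UNIV = (\<lambda>x. x)"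
      by auto
    ultimately show "\<one>\<^bsub>BijGroup UNIV\<^esub> \<in> ?A"
      by (simp add: BijGroup_def bij_def)
  next
    fix x y assume xy: "x \<in> ?A" "y \<in> ?A"
    then have "x \<circ> y \<in> ?A"
      by (auto simp: bij_comp o_inv_distrib polynomial_map_comp)
    moreover have "x \<otimes>\<^bsub>BijGroup UNIV\<^esub> y = x \<circ> y"
      using xy by (auto simp: BijGroup_def B compose_def fun_eq_iff)
    ultimately show "x \<otimes>\<^bsub>BijGroup UNIV\<^esub> y \<in> ?A"
      by metis
  next
    fix x assume x: "x \<in> ?A"
    then have "inv_into UNIV x \<in> ?A"
      by (auto simp: bij_imp_bij_inv inv_inv_eq)
    moreover have "inv\<^bsub>BijGroup UNIV\<^esub> x = inv_into UNIV x"
      using x by (subst inv_BijGroup) (auto simp: B)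
    ultimately show "inv\<^bsub>BijGroup UNIV\<^esub> x \<in> ?A"
      by metis
  qed
  then show ?thesis
    unfolding Aut_affine_def by (rule subgroup.subgroup_is_group[OF _ group_BijGroup])
qed

end

theory Submission
  imports Defs "HOL-Analysis.Determinants"
begin

text \<open>
  Let \<open>\<theta>\<close> be an automorphism of one of the three Lie algebras \<open>\<gg>\<close>, and \<open>D\<^sub>k = \<theta> \<partial>\<^sub>k\<close>. The
  commuting fields \<open>D\<^sub>k\<close> are linearly independent over the polynomial ring and have
  divergence zero, so \<open>det (D\<^sub>k x\<^sub>l)\<close> is a nonzero constant and they form a basis of all
  vector fields over the ring. Expanding the image of a diagonal field
  \<open>h = \<Sum> a\<^sub>l x\<^sub>l \<partial>\<^sub>l \<in> \<gg>\<close> with all \<open>a\<^sub>l \<noteq> 0\<close> as \<open>\<Sum> a\<^sub>l y\<^sub>l D\<^sub>l\<close> gives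
  polynomials with \<open>D\<^sub>k y\<^sub>l = \<delta>\<^sub>k\<^sub>l\<close>. Let \<open>Y\<close> be the endomorphism \<open>x\<^sub>l \<mapsto> y\<^sub>l\<close>. The fields
  \<open>\<delta> \<in> \<gg>\<close> with \<open>\<theta> \<delta> \<circ> Y = Y \<circ> \<delta>\<close> form a Lie subalgebra that contains \<open>h\<close> and the \<open>\<partial>\<^sub>k\<close>;
  an induction on the degree that compares weights of diagonal fields shows that it is
  all of \<open>\<gg>\<close>. If \<open>Z\<close> belongs in the same way to \<open>\<theta>\<^sup>-\<^sup>1\<close>, then \<open>Y Z\<close> and \<open>Z Y\<close> commute with
  \<open>\<gg>\<close>, hence are the identity, and \<open>\<theta>\<close> is the conjugation by \<open>Y\<close>.
\<close>

section \<open>The coordinate ring\<close>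

lemma const_0 [simp]: "const 0 = 0"
  and const_1 [simp]: "const 1 = 1"
  and const_add: "const (a + b) = const a + const b"
  and const_mult: "const (a * b) = const a * const b"
  and const_uminus: "const (- a) = - const a"
  and const_eq_0_iff [simp]: "const a = 0 \<longleftrightarrow> a = 0"
  by (simp_all add: const_def single_add mult_single single_uminus)
    (metis lookup_single_eq lookup_zero single_zero)

lemma const_of_nat: "const (of_nat m) = of_nat m"
  by (induction m) (simp_all add: const_add)

lemma const_of_int: "const (of_int z) = of_int z"
  by (cases z rule: int_diff_cases) (simp add: const_of_nat flip: const_diff)

lemma const_numeral: "const (numeral m) = numeral m"
  by (metis const_of_nat of_nat_numeral)

lemma partial_1 [simp]: "partial k 1 = 0"
  by (metis const_1 partial_const)

section \<open>Restriction to lines and the absence of zero divisors\<close>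

lemma eval_on_line:
  fixes p :: "('k::comm_ring_1, 'n::finite) mpoly"
  shows "\<exists>u. \<forall>t. poly u t = eval p (\<chi> i. x $ i + t * y $ i)"
proof (induction p rule: mpoly_induct)
  case (const c)
  show ?case by (rule exI[of _ "[:c:]"]) simp
next
  case (var i q)
  then obtain u where "\<forall>t. poly u t = eval q (\<chi> i. x $ i + t * y $ i)" ..
  then show ?case by (intro exI[of _ "[:x $ i, y $ i:] * u"]) (simp add: distrib_right mult.assoc)
next
  case (add p q)
  then obtain u v where "\<forall>t. poly u t = eval p (\<chi> i. x $ i + t * y $ i)"
    "\<forall>t. poly v t = eval q (\<chi> i. x $ i + t * y $ i)"
    by blast
  then show ?case by (intro exI[of _ "u + v"]) simp
qed

text \<open>A line joins a point where \<open>p\<close> does not vanish to a point where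
  \<open>q\<close> does not. The restrictions of \<open>p\<close> and \<open>q\<close> to it are
  nonzero univariate polynomials, so their product cannot vanish at every point of an infinite
  field.\<close>

lemma mpoly_no_zero_divisors:
  fixes p q :: "('k::field_char_0, 'n::finite) mpoly"
  assumes "p * q = 0"
  shows "p = 0 \<or> q = 0"
proof (rule ccontr)
  assume "\<not> (p = 0 \<or> q = 0)"
  then obtain x y where x: "eval p x \<noteq> 0" and y: "eval q y \<noteq> 0"
    using eval_eq_0_imp[of UNIV p] eval_eq_0_imp[of UNIV q] by auto
  obtain u where u: "\<And>t. poly u t = eval p (\<chi> i. x $ i + t * (y - x) $ i)"
    using eval_on_line[of p x "y - x"] by blast
  obtain v where v: "\<And>t. poly v t = eval q (\<chi> i. x $ i + t * (y - x) $ i)"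
    using eval_on_line[of q x "y - x"] by blast
  have "poly u 0 \<noteq> 0" "poly v 1 \<noteq> 0"
    using x y by (simp_all add: u v)
  moreover have "poly (u * v) t = 0" for t
    by (simp add: u v assms flip: eval_mult)
  ultimately have "u \<noteq> 0" "v \<noteq> 0" "u * v = 0"
    using poly_all_0_iff_0[of "u * v"] by auto
  then show False
    by simp
qed

lemma mpoly_mult_eq_0_iff [simp]:
  fixes p q :: "('k::field_char_0, 'n::finite) mpoly"
  shows "p * q = 0 \<longleftrightarrow> p = 0 \<or> q = 0"
  using mpoly_no_zero_divisors by auto

lemma mpoly_mult_left_cancel:
  fixes p q r :: "('k::field_char_0, 'n::finite) mpoly"
  assumes "r \<noteq> 0"
  shows "r * p = r * q \<longleftrightarrow> p = q"
  using mpoly_mult_eq_0_iff[of r "p - q"] assms by (simp add: right_diff_distrib)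

lemma mpoly_prod_eq_0_iff:
  fixes f :: "'a \<Rightarrow> ('k::field_char_0, 'n::finite) mpoly"
  assumes "finite A"
  shows "prod f A = 0 \<longleftrightarrow> (\<exists>a\<in>A. f a = 0)"
  using assms by (induction A rule: finite_induct) auto

lemma partials_0_imp_const:
  fixes p :: "('k::field_char_0, 'n::finite) mpoly"
  assumes "\<And>k. partial k p = 0"
  obtains c where "p = const c"
proof
  show "p = const (Poly_Mapping.lookup p 0)"
  proof (rule poly_mapping_eqI)
    fix m
    show "Poly_Mapping.lookup p m = Poly_Mapping.lookup (const (Poly_Mapping.lookup p 0)) m"
    proof (cases "m = 0")
      case True
      then show ?thesis by (simp add: const_def)
    next
      case False
      then obtain i where i: "Poly_Mapping.lookup m i > 0"
        by (metis gr0I lookup_zero poly_mapping_eqI)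
      then have "m - Poly_Mapping.single i 1 + Poly_Mapping.single i 1 = m"
        by (intro poly_mapping_eqI) (auto simp: lookup_add lookup_minus lookup_single when_def)
      then have "Poly_Mapping.lookup p m = 0"
        using lookup_partial[of i p "m - Poly_Mapping.single i 1"] assms[of i]
        by (metis lookup_zero mult_eq_0_iff of_nat_neq_0)
      then show ?thesis
        using False by (simp add: const_def lookup_single when_def)
    qed
  qed
qed

section \<open>Comorphisms as ring homomorphisms, contravariant in the map\<close>

lemma polynomial_map_comorphism:
  fixes \<phi> \<psi> :: "'k::field_char_0 ^ 'n::finite \<Rightarrow> 'k ^ 'n"
  assumes "polynomial_map \<phi>"
  shows comorphism_add: "comorphism \<phi> (p + q) = comorphism \<phi> p + comorphism \<phi> q"
    and comorphism_mult: "comorphism \<phi> (p * q) = comorphism \<phi> p * comorphism \<phi> q"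
    and comorphism_diff: "comorphism \<phi> (p - q) = comorphism \<phi> p - comorphism \<phi> q"
    and comorphism_const: "comorphism \<phi> (const c) = const c"
    and comorphism_0: "comorphism \<phi> 0 = 0"
    and comorphism_1: "comorphism \<phi> 1 = 1"
    and comorphism_sum: "comorphism \<phi> (\<Sum>a\<in>A. f a) = (\<Sum>a\<in>A. comorphism \<phi> (f a))"
    and comorphism_comp:
      "polynomial_map \<psi> \<Longrightarrow> comorphism (\<phi> \<circ> \<psi>) p = comorphism \<psi> (comorphism \<phi> p)"
proof -
  note e = eval_comorphism[OF assms]
  show add: "comorphism \<phi> (p + q) = comorphism \<phi> p + comorphism \<phi> q" for p q
    by (rule iffD1[OF eval_inject]) (auto simp: fun_eq_iff e)
  show "comorphism \<phi> (p * q) = comorphism \<phi> p * comorphism \<phi> q"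
    "comorphism \<phi> (p - q) = comorphism \<phi> p - comorphism \<phi> q"
    by (rule iffD1[OF eval_inject]; auto simp: fun_eq_iff e)+
  show const: "comorphism \<phi> (const c) = const c" for c
    by (rule iffD1[OF eval_inject]) (auto simp: fun_eq_iff e)
  show zero: "comorphism \<phi> 0 = 0" "comorphism \<phi> 1 = 1"
    using const[of 0] const[of 1] by simp_all
  show "comorphism \<phi> (\<Sum>a\<in>A. f a) = (\<Sum>a\<in>A. comorphism \<phi> (f a))"
    by (induction A rule: infinite_finite_induct) (auto simp: add zero)
  show "comorphism (\<phi> \<circ> \<psi>) p = comorphism \<psi> (comorphism \<phi> p)" if "polynomial_map \<psi>"
    by (rule iffD1[OF eval_inject])
      (auto simp: fun_eq_iff e eval_comorphism[OF that]
        eval_comorphism[OF polynomial_map_comp[OF assms that]])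
qed

lemma polynomial_map_id: "polynomial_map (id :: 'k::field_char_0 ^ 'n::finite \<Rightarrow> 'k ^ 'n)"
  unfolding polynomial_map_def by (rule exI[of _ var]) simp

lemma comorphism_id [simp]:
  "comorphism id = (id :: ('k::field_char_0, 'n::finite) mpoly \<Rightarrow> _)"
proof
  show "comorphism id p = id p" for p :: "('k, 'n) mpoly"
    by (rule iffD1[OF eval_inject]) (simp add: eval_comorphism polynomial_map_id)
qed

text \<open>The comorphism of \<open>poly_map F\<close> is the endomorphism of the coordinate ring
  that substitutes \<open>F i\<close> for \<open>var i\<close>; ring endomorphisms are represented
  in this form throughout.\<close>

definition poly_map :: "('n::finite \<Rightarrow> ('k::comm_ring_1, 'n) mpoly) \<Rightarrow> 'k ^ 'n \<Rightarrow> 'k ^ 'n"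
  where "poly_map F x = (\<chi> i. eval (F i) x)"

lemma polynomial_map_poly_map [simp]: "polynomial_map (poly_map F)"
  by (auto simp: polynomial_map_def poly_map_def)

lemma comorphism_poly_map_var [simp]:
  fixes F :: "'n::finite \<Rightarrow> ('k::field_char_0, 'n) mpoly"
  shows "comorphism (poly_map F) (var i) = F i"
  by (rule iffD1[OF eval_inject]) (auto simp: fun_eq_iff eval_comorphism poly_map_def)

lemma polynomial_map_eq_id:
  fixes \<phi> :: "'k::field_char_0 ^ 'n::finite \<Rightarrow> 'k ^ 'n"
  assumes "polynomial_map \<phi>" "\<And>i. comorphism \<phi> (var i) = var i"
  shows "\<phi> = id"
proof
  fix x
  show "\<phi> x = id x"
    using fun_cong[OF eval_comorphism[OF assms(1), of "var i" for i], where x = x]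
    by (simp add: assms(2) vec_eq_iff)
qed

section \<open>Derivations\<close>

lemma Vec_I:
  assumes "\<And>f g. \<delta> (f + g) = \<delta> f + \<delta> g" "\<And>c f. \<delta> (const c * f) = const c * \<delta> f"
    "\<And>f g. \<delta> (f * g) = \<delta> f * g + f * \<delta> g"
  shows "\<delta> \<in> Vec"
  using assms by (simp add: Vec_def)

lemma Vec_1: "\<delta> \<in> Vec \<Longrightarrow> \<delta> 1 = 0"
  by (metis VecD(6) const_1)

lemma Vec_sum:
  assumes "\<delta> \<in> Vec"
  shows "\<delta> (\<Sum>a\<in>A. f a) = (\<Sum>a\<in>A. \<delta> (f a))"
  by (induction A rule: infinite_finite_induct) (auto simp: VecD[OF assms])

lemma Vec_expand:
  fixes \<delta> :: "('k::comm_ring_1, 'n::finite) operator"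
  assumes "\<delta> \<in> Vec"
  shows "\<delta> p = (\<Sum>i\<in>UNIV. \<delta> (var i) * partial i p)"
proof -
  obtain F where "\<delta> = vector_field F"
    using assms by (auto simp: Vec_eq)
  then have "\<delta> p = vector_field F p" "\<And>i. \<delta> (var i) = F i"
    by simp_all
  then show ?thesis
    by (simp add: vector_field_def)
qed

lemma Vec_eqI:
  fixes \<delta> :: "('k::comm_ring_1, 'n::finite) operator"
  assumes "\<delta> \<in> Vec" "\<epsilon> \<in> Vec" "\<And>i. \<delta> (var i) = \<epsilon> (var i)"
  shows "\<delta> = \<epsilon>"
  by (rule ext, subst Vec_expand[OF assms(1)], subst Vec_expand[OF assms(2)]) (simp add: assms(3))

lemma Vec_partial: "partial k \<in> Vec"
  by (rule Vec_I) simp_all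

lemma Vec_zero: "(\<lambda>p. 0) \<in> Vec"
  by (rule Vec_I) simp_all

lemma Vec_mult_left: "\<delta> \<in> Vec \<Longrightarrow> (\<lambda>p. f * \<delta> p) \<in> Vec"
  by (rule Vec_I) (simp_all add: VecD algebra_simps)

lemma Vec_add: "\<delta> \<in> Vec \<Longrightarrow> \<epsilon> \<in> Vec \<Longrightarrow> (\<lambda>p. \<delta> p + \<epsilon> p) \<in> Vec"
  by (rule Vec_I) (simp_all add: VecD algebra_simps)

lemma Vec_bracket:
  assumes "\<delta> \<in> Vec" "\<epsilon> \<in> Vec"
  shows "(\<lambda>p. \<delta> (\<epsilon> p) - \<epsilon> (\<delta> p)) \<in> Vec"
  using assms lie_subalgebra_Vec by (auto simp: lie_subalgebra_def lie_bracket_def)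

lemma Vec_combination: "(\<And>a. a \<in> A \<Longrightarrow> D a \<in> Vec) \<Longrightarrow> (\<lambda>p. \<Sum>a\<in>A. f a * D a p) \<in> Vec"
  by (induction A rule: infinite_finite_induct) (auto intro!: Vec_zero Vec_add Vec_mult_left)

section \<open>Linear independence over the coordinate ring\<close>

definition independent_ops :: "'a set \<Rightarrow> ('a \<Rightarrow> ('k::comm_ring_1, 'n) operator) \<Rightarrow> bool"
  where "independent_ops S D \<longleftrightarrow>
    (\<forall>c. (\<forall>p. (\<Sum>s\<in>S. c s * D s p) = 0) \<longrightarrow> (\<forall>s\<in>S. c s = 0))"

lemma independent_opsD:
  assumes "independent_ops S D" "\<And>p. (\<Sum>s\<in>S. c s * D s p) = (\<Sum>s\<in>S. d s * D s p)" "s \<in> S"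
  shows "c s = d s"
proof -
  have "(\<Sum>s\<in>S. (c s - d s) * D s p) = 0" for p
    using assms(2)[of p] by (simp add: left_diff_distrib sum_subtractf)
  then have "c s - d s = 0"
    using assms(1,3) unfolding independent_ops_def by meson
  then show ?thesis by simp
qed

text \<open>Gaussian elimination without division. Each round uses a nonzero entry as pivot to clear
  one coordinate and drops the pivot vector, so the surplus of vectors over coordinates
  persists.\<close>

lemma linear_dependence:
  fixes v :: "'a \<Rightarrow> 'b \<Rightarrow> ('k::field_char_0, 'n::finite) mpoly"
  assumes "finite L" "finite J" "card L < card J"
  shows "\<exists>c. (\<exists>j\<in>J. c j \<noteq> 0) \<and> (\<forall>l\<in>L. (\<Sum>j\<in>J. c j * v j l) = 0)"
  using assms
proof (induction L arbitrary: J v rule: finite_induct)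
  case empty
  then show ?case by (intro exI[of _ "\<lambda>_. 1"]) (auto simp: card_gt_0_iff)
next
  case (insert l L)
  show ?case
  proof (cases "\<forall>j\<in>J. v j l = 0")
    case True
    from insert.hyps insert.prems have "card L < card J" by simp
    then obtain c where "\<exists>j\<in>J. c j \<noteq> 0" "\<forall>l\<in>L. (\<Sum>j\<in>J. c j * v j l) = 0"
      using insert.IH[OF insert.prems(1)] by blast
    then show ?thesis using True by (intro exI[of _ c]) auto
  next
    case False
    then obtain i where i: "i \<in> J" "v i l \<noteq> 0" by blast
    \<comment> \<open>\<open>?w j\<close> is \<open>v j\<close> scaled by the pivot
      \<open>v i l\<close>, with the entry at \<open>l\<close> cleared. A relation between the
      \<open>?w j\<close> becomes one between the \<open>v j\<close> after scaling by the same
      pivot, which is nonzero.\<close>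
    let ?J = "J - {i}" and ?w = "\<lambda>j m. v i l * v j m - v j l * v i m"
    have "card L < card ?J"
      using insert.hyps insert.prems i by simp
    then obtain c where c: "\<exists>j\<in>?J. c j \<noteq> 0" "\<And>m. m \<in> L \<Longrightarrow> (\<Sum>j\<in>?J. c j * ?w j m) = 0"
      using insert.IH[of ?J ?w] insert.prems(1) by blast
    define e where "e j = (if j = i then - (\<Sum>j\<in>?J. c j * v j l) else v i l * c j)" for j
    have sum: "(\<Sum>j\<in>J. e j * v j m) = (\<Sum>j\<in>?J. c j * ?w j m)" for m
    proof -
      have "(\<Sum>j\<in>J. e j * v j m) = e i * v i m + (\<Sum>j\<in>?J. e j * v j m)"
        using insert.prems(1) i(1) by (rule sum.remove)
      also have "(\<Sum>j\<in>?J. e j * v j m) = (\<Sum>j\<in>?J. v i l * c j * v j m)"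
        by (rule sum.cong) (auto simp: e_def)
      finally show ?thesis
        by (simp add: e_def right_diff_distrib sum_subtractf sum_distrib_left mult_ac)
    qed
    have "(\<Sum>j\<in>J. e j * v j m) = 0" if "m \<in> insert l L" for m
      using that c(2) unfolding sum by (auto simp: mult.commute)
    moreover have "\<exists>j\<in>J. e j \<noteq> 0"
      using c(1) i by (auto simp: e_def)
    ultimately show ?thesis by blast
  qed
qed

text \<open>
  A relation \<open>h D\<^sub>i = - \<Sum> c\<^sub>l D\<^sub>l\<close> expresses, after bracketing with \<open>Q\<close>, a multiple of \<open>E\<close>
  by the independent \<open>D\<^sub>l\<close>. Bracketing with these shows that the coefficients \<open>f\<^sub>l / h\<^sup>2\<close>
  are annihilated by all \<open>D\<^sub>l\<close>, hence by \<open>D\<^sub>i\<close>, which contradicts \<open>[D\<^sub>i, E] = D\<^sub>j \<noteq> 0\<close>.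
\<close>

lemma commuting_independent:
  fixes D :: "'a::finite \<Rightarrow> ('k::field_char_0, 'n::finite) operator"
  assumes D: "\<And>k. D k \<in> Vec" and nz: "\<And>k. \<exists>p. D k p \<noteq> 0"
    and comm: "\<And>k l p. D k (D l p) = D l (D k p)"
    and QE: "\<And>i j. i \<noteq> j \<Longrightarrow> \<exists>Q\<in>Vec. \<exists>E\<in>Vec.
      (\<forall>p. D i (Q p) = Q (D i p) + 2 * E p) \<and> (\<forall>p. D i (E p) = E (D i p) + D j p) \<and>
      (\<forall>k p. k \<noteq> i \<longrightarrow> D k (Q p) = Q (D k p) \<and> D k (E p) = E (D k p))"
  shows "independent_ops UNIV D"
proof -
  have "\<exists>S. independent_ops S D \<and> (\<forall>T. independent_ops T D \<longrightarrow> S \<subseteq> T \<longrightarrow> T = S)"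
  proof -
    have "finite {S. independent_ops S D}" by simp
    moreover have "{} \<in> {S. independent_ops S D}" by (simp add: independent_ops_def)
    ultimately obtain S where "S \<in> {S. independent_ops S D}"
      "\<And>T. T \<in> {S. independent_ops S D} \<Longrightarrow> S \<subseteq> T \<Longrightarrow> S = T"
      using finite_has_maximal2 by (metis (no_types, lifting))
    then show ?thesis by blast
  qed
  then obtain S where S: "independent_ops S D" and max: "\<And>T. independent_ops T D \<Longrightarrow> S \<subseteq> T \<Longrightarrow> T = S"
    by blast
  have False if "S \<noteq> UNIV"
  proof -
    from that obtain i where i: "i \<notin> S" by blast
    have "independent_ops {i} D"
      unfolding independent_ops_def using nz[of i] by auto
    then have "S \<noteq> {}"
      using max by auto
    then obtain j where j: "j \<in> S" by blast
    with i have "i \<noteq> j" by blast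
    from QE[OF this] obtain Q E where Q: "Q \<in> Vec" and E: "E \<in> Vec"
      and QEi: "\<forall>p. D i (Q p) = Q (D i p) + 2 * E p" "\<forall>p. D i (E p) = E (D i p) + D j p"
      and QEk: "\<forall>k p. k \<noteq> i \<longrightarrow> D k (Q p) = Q (D k p) \<and> D k (E p) = E (D k p)"
      by (elim bexE conjE)
    note Qi = QEi(1)[rule_format] and Ei = QEi(2)[rule_format]
    note Qk = QEk[rule_format, THEN conjunct1] and Ek = QEk[rule_format, THEN conjunct2]
    have "\<not> independent_ops (insert i S) D"
      using max[of "insert i S"] i by blast
    then obtain c s where c: "\<And>p. (\<Sum>s\<in>insert i S. c s * D s p) = 0" and s: "s \<in> insert i S" "c s \<noteq> 0"
      unfolding independent_ops_def by blast
    define h where "h = c i"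
    have hD: "h * D i p = - (\<Sum>s\<in>S. c s * D s p)" for p
      using c[of p] i by (simp add: h_def eq_neg_iff_add_eq_0)
    have h: "h \<noteq> 0"
    proof
      assume "h = 0"
      then have "\<forall>s\<in>S. c s = 0"
        using S hD unfolding independent_ops_def by simp
      with \<open>h = 0\<close> s show False by (auto simp: h_def)
    qed
    \<comment> \<open>Bracketing the relation with \<open>Q\<close> leaves \<open>2 h E\<close> as a
      combination of \<open>D i\<close> and the \<open>D l\<close>, because \<open>Q\<close>
      commutes with \<open>D l\<close> for \<open>l\<close> in \<open>S\<close>. A further factor
      \<open>h\<close> allows \<open>D i\<close> to be eliminated by the relation itself.\<close>
    define f where "f l = h * Q (c l) - Q h * c l" for l
    have hE: "2 * h * h * E p = (\<Sum>l\<in>S. f l * D l p)" for p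
    proof -
      have "Q (h * D i p) = - (\<Sum>s\<in>S. Q (c s) * D s p) - (\<Sum>s\<in>S. c s * Q (D s p))"
        unfolding hD using VecD(5)[OF Q, of 0] VecD(4)[OF Q]
        by (simp add: Vec_sum[OF Q] VecD(3)[OF Q] sum.distrib)
      moreover have "h * D i (Q p) = - (\<Sum>s\<in>S. c s * Q (D s p))"
        unfolding hD by (intro arg_cong[of _ _ uminus] sum.cong refl) (metis Qk i)
      ultimately have "Q h * D i p + h * Q (D i p)
          = h * (Q (D i p) + 2 * E p) - (\<Sum>s\<in>S. Q (c s) * D s p)"
        by (simp add: VecD(3)[OF Q] Qi)
      then have "Q h * D i p + (\<Sum>s\<in>S. Q (c s) * D s p) = 2 * h * E p"
        by (simp add: algebra_simps)
      then have "2 * h * h * E p = Q h * (h * D i p) + h * (\<Sum>s\<in>S. Q (c s) * D s p)"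
        by (metis (no_types, lifting) mult.assoc mult.commute distrib_left)
      then show ?thesis
        unfolding hD by (simp add: f_def sum_subtractf sum_distrib_left algebra_simps)
    qed
    have D_hE: "D k (2 * h * h) * E p + 2 * h * h * D k (E p)
        = (\<Sum>l\<in>S. D k (f l) * D l p) + 2 * h * h * E (D k p)" for k p
    proof -
      have "D k (2 * h * h) * E p + 2 * h * h * D k (E p) = D k (2 * h * h * E p)"
        by (simp add: VecD(3)[OF D])
      also have "\<dots> = (\<Sum>l\<in>S. D k (f l) * D l p) + (\<Sum>l\<in>S. f l * D l (D k p))"
        unfolding hE by (simp add: Vec_sum[OF D] VecD(3)[OF D] sum.distrib comm[of k])
      finally show ?thesis unfolding hE[symmetric] .
    qed
    \<comment> \<open>With denominators cleared this reads \<open>D k (f l / (2 h h)) = 0\<close>.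
      It compares coefficients after bracketing the expansion of \<open>E\<close> with
      \<open>D k\<close>, which commutes with \<open>E\<close>.\<close>
    have ff: "2 * h * h * D k (f l) = D k (2 * h * h) * f l" if "k \<in> S" "l \<in> S" for k l
    proof (rule independent_opsD[OF S _ that(2)])
      fix p
      have "k \<noteq> i" using that i by blast
      then have eq: "(\<Sum>l\<in>S. D k (f l) * D l p) = D k (2 * h * h) * E p"
        using D_hE[of k p] Ek[of k p] by simp
      have "2 * h * h * (\<Sum>l\<in>S. D k (f l) * D l p) = D k (2 * h * h) * (2 * h * h * E p)"
        unfolding eq by (rule mult.left_commute)
      then show "(\<Sum>l\<in>S. 2 * h * h * D k (f l) * D l p) = (\<Sum>l\<in>S. D k (2 * h * h) * f l * D l p)"
        unfolding hE by (simp add: sum_distrib_left mult.assoc)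
    qed
    have fi: "2 * h * h * D i (f l) = D i (2 * h * h) * f l" if "l \<in> S" for l
    proof -
      have "h * (2 * h * h * D i (f l)) = 2 * h * h * (h * D i (f l))"
        by (simp add: mult_ac)
      also have "\<dots> = - (\<Sum>k\<in>S. c k * (2 * h * h * D k (f l)))"
        unfolding hD by (simp add: sum_distrib_left mult_ac)
      also have "\<dots> = - (\<Sum>k\<in>S. c k * (D k (2 * h * h) * f l))"
        by (intro arg_cong[of _ _ uminus] sum.cong refl) (simp add: ff that)
      also have "\<dots> = h * D i (2 * h * h) * f l"
        unfolding hD by (simp add: sum_distrib_left mult_ac)
      finally show ?thesis
        using mpoly_mult_left_cancel[OF h] by (simp add: mult_ac)
    qed
    \<comment> \<open>Bracketing the expansion of \<open>E\<close> with \<open>D i\<close>: its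
      coefficients are constants for \<open>D i\<close> by \<open>fi\<close>, so
      \<open>[D i, E] = D j\<close> would have to vanish up to a nonzero factor.\<close>
    have "2 * h * h * (2 * h * h) * D j p = 0" for p
    proof -
      have "D i (2 * h * h) * E p + 2 * h * h * D j p = (\<Sum>l\<in>S. D i (f l) * D l p)"
        using D_hE[of i p] Ei[of p] by (simp add: algebra_simps)
      then have "2 * h * h * (D i (2 * h * h) * E p + 2 * h * h * D j p)
          = (\<Sum>l\<in>S. 2 * h * h * D i (f l) * D l p)"
        by (simp add: sum_distrib_left mult.assoc)
      also have "\<dots> = D i (2 * h * h) * (\<Sum>l\<in>S. f l * D l p)"
        unfolding sum_distrib_left by (intro sum.cong refl) (simp add: fi flip: mult.assoc)
      also have "\<dots> = D i (2 * h * h) * (2 * h * h * E p)"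
        by (simp add: hE)
      finally show ?thesis by (simp add: algebra_simps)
    qed
    then show False
      using h nz[of j] by simp
  qed
  then show ?thesis using S by blast
qed

section \<open>Determinants and divergence\<close>

definition replace_row :: "'n \<Rightarrow> 'r ^ 'n \<Rightarrow> 'r ^ 'n ^ 'n \<Rightarrow> 'r ^ 'n ^ 'n"
  where "replace_row k v A = (\<chi> i. if i = k then v else A $ i)"

lemma det_replace_row_combination:
  fixes A :: "'r::comm_ring_1 ^ 'n ^ 'n"
  shows "det (replace_row k (\<Sum>i\<in>S. c i *s v i) A) = (\<Sum>i\<in>S. c i * det (replace_row k (v i) A))"
proof (cases "finite S")
  case True
  then show ?thesis
    unfolding replace_row_def by (subst det_linear_row_sum) (auto simp: det_row_mul)
next
  case False
  then show ?thesis by (simp add: replace_row_def det_row_0)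
qed

lemma det_replace_row_row:
  fixes A :: "'r::comm_ring_1 ^ 'n ^ 'n"
  shows "det (replace_row k (A $ j) A) = (if j = k then det A else 0)"
proof (cases "j = k")
  case True
  then have "replace_row k (A $ j) A = A"
    by (simp add: replace_row_def vec_eq_iff)
  then show ?thesis using True by simp
next
  case False
  then show ?thesis
    by (simp add: det_identical_rows[OF False] replace_row_def row_def)
qed

text \<open>Encoding the signed minor as a determinant with a unit vector in row \<open>k\<close>
  turns the cofactor expansion into linearity of \<open>det\<close> in that row.\<close>

definition cofactor :: "'r::comm_ring_1 ^ 'n ^ 'n \<Rightarrow> 'n \<Rightarrow> 'n \<Rightarrow> 'r"
  where "cofactor A k l = det (replace_row k (axis l 1) A)"

lemma cofactor_expansion:
  fixes A :: "'r::comm_ring_1 ^ 'n ^ 'n"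
  shows "(\<Sum>l\<in>UNIV. A $ j $ l * cofactor A k l) = (if j = k then det A else 0)"
proof -
  have "(\<Sum>l\<in>UNIV. A $ j $ l *s axis l 1) = A $ j"
    by (simp add: vec_eq_iff axis_def if_distrib[of "\<lambda>x. _ * x"] cong: if_cong)
  then show ?thesis
    unfolding cofactor_def det_replace_row_combination[symmetric] by (simp add: det_replace_row_row)
qed

section \<open>Derivatives of products and determinants\<close>

lemma Vec_prod:
  assumes "\<delta> \<in> Vec" "finite A"
  shows "\<delta> (\<Prod>a\<in>A. f a) = (\<Sum>a\<in>A. \<Prod>b\<in>A. if b = a then \<delta> (f b) else f b)"
  using assms(2)
proof (induction A rule: finite_induct)
  case empty
  then show ?case using VecD(6)[OF assms(1), of 1] by simp
next
  case (insert x A)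
  have "(\<Prod>b\<in>A. if b = x then \<delta> (f b) else f b) = prod f A"
    using insert.hyps by (intro prod.cong) auto
  moreover have "(\<Sum>a\<in>A. (if x = a then \<delta> (f x) else f x) * (\<Prod>b\<in>A. if b = a then \<delta> (f b) else f b))
      = (\<Sum>a\<in>A. f x * (\<Prod>b\<in>A. if b = a then \<delta> (f b) else f b))"
    using insert.hyps by (intro sum.cong) auto
  ultimately show ?case
    using insert by (simp add: VecD(3)[OF assms(1)] sum_distrib_left)
qed

lemma Vec_det:
  fixes A :: "('k::comm_ring_1, 'n::finite) mpoly ^ 'm ^ 'm"
  assumes "\<delta> \<in> Vec"
  shows "\<delta> (det A) = (\<Sum>k\<in>UNIV. det (replace_row k (\<chi> j. \<delta> (A $ k $ j)) A))"
proof -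
  have int: "\<delta> (of_int z * p) = of_int z * \<delta> p" for z p
    by (metis VecD(2)[OF assms] const_of_int)
  have "\<delta> (det A) = (\<Sum>p | p permutes UNIV. \<Sum>k\<in>UNIV. of_int (sign p) *
      (\<Prod>i\<in>UNIV. if i = k then \<delta> (A $ i $ p i) else A $ i $ p i))"
    unfolding det_def by (simp add: Vec_sum[OF assms] int Vec_prod[OF assms] sum_distrib_left)
  also have "\<dots> = (\<Sum>k\<in>UNIV. \<Sum>p | p permutes UNIV. of_int (sign p) *
      (\<Prod>i\<in>UNIV. if i = k then \<delta> (A $ i $ p i) else A $ i $ p i))"
    by (rule sum.swap)
  also have "\<dots> = (\<Sum>k\<in>UNIV. det (replace_row k (\<chi> j. \<delta> (A $ k $ j)) A))"
    unfolding det_def replace_row_def by (intro sum.cong prod.cong arg_cong2[of _ _ _ _ "(*)"] refl) auto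
  finally show ?thesis .
qed

text \<open>
  With \<open>d = det (D\<^sub>k x\<^sub>l)\<close>, the first equation says that the Lie derivative of
  \<open>D\<^sub>1 \<and> \<dots> \<and> D\<^sub>n = d \<partial>\<^sub>1 \<and> \<dots> \<and> \<partial>\<^sub>n\<close> along each of the commuting \<open>D\<^sub>m\<close> is zero.
\<close>

lemma commuting_frame:
  fixes D :: "'n::finite \<Rightarrow> ('k::field_char_0, 'n) operator"
  assumes D: "\<And>k. D k \<in> Vec" and comm: "\<And>k l p. D k (D l p) = D l (D k p)"
    and ind: "independent_ops UNIV D"
  obtains d M where "d \<noteq> 0" "\<And>m. D m d = divergence (D m) * d"
    "\<And>k p. d * partial k p = (\<Sum>l\<in>UNIV. M k l * D l p)"
proof -
  define B :: "('k, 'n) mpoly ^ 'n ^ 'n" where "B = (\<chi> l k. D k (var l))"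
  have B: "B $ l $ k = D k (var l)" for l k by (simp add: B_def)
  define J where "J m j l = partial j (D m (var l))" for m j l
  have "D m (det B) = divergence (D m) * det B" for m
  proof -
    \<comment> \<open>Rows belong to variables and columns to fields. Since \<open>D m\<close> and
      \<open>D k\<close> commute, the chain rule for \<open>D k\<close> makes the differentiated row
      a combination of rows of \<open>B\<close>. In the determinant only the diagonal coefficients
      survive, and they add up to the divergence.\<close>
    have row: "(\<chi> k. D m (B $ l $ k)) = (\<Sum>j\<in>UNIV. J m j l *s B $ j)" for l
      unfolding vec_eq_iff
    proof
      fix k
      have "D m (D k (var l)) = D k (D m (var l))" by (rule comm)
      also have "\<dots> = (\<Sum>j\<in>UNIV. D k (var j) * partial j (D m (var l)))" by (rule Vec_expand[OF D])
      finally show "(\<chi> k. D m (B $ l $ k)) $ k = (\<Sum>j\<in>UNIV. J m j l *s B $ j) $ k"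
        by (simp add: B J_def mult.commute)
    qed
    have "D m (det B) = (\<Sum>l\<in>UNIV. \<Sum>j\<in>UNIV. J m j l * (if j = l then det B else 0))"
      unfolding Vec_det[OF D] row det_replace_row_combination det_replace_row_row ..
    also have "\<dots> = (\<Sum>l\<in>UNIV. J m l l * det B)"
      by (simp add: if_distrib[of "\<lambda>x. _ * x"] cong: if_cong)
    finally show ?thesis
      by (simp add: J_def divergence_def sum_distrib_right)
  qed
  \<comment> \<open>Cramer's rule: on the variables this is the cofactor expansion.\<close>
  moreover have "det B * partial k p = (\<Sum>l\<in>UNIV. cofactor B k l * D l p)" for k p
  proof -
    have "(\<lambda>p. det B * partial k p) = (\<lambda>p. \<Sum>l\<in>UNIV. cofactor B k l * D l p)"
    proof (rule Vec_eqI)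
      show "det B * partial k (var i) = (\<Sum>l\<in>UNIV. cofactor B k l * D l (var i))" for i
        using cofactor_expansion[of B i k] by (auto simp: B partial_var mult.commute)
    qed (intro Vec_mult_left Vec_partial Vec_combination D)+
    then show ?thesis by (rule fun_cong)
  qed
  moreover have "det B \<noteq> 0"
  proof -
    have "\<exists>h c. h \<noteq> 0 \<and> (\<forall>p. h * partial l p = (\<Sum>k\<in>UNIV. c k * D k p))" for l
    proof -
      \<comment> \<open>\<open>None\<close> stands for \<open>partial l\<close>. The
        \<open>CARD('n) + 1\<close> fields have only \<open>CARD('n)\<close> components each, hence
        are dependent, and the independence of the \<open>D k\<close> makes the coefficient of
        \<open>partial l\<close> nonzero.\<close>
      define v where "v j m = (case j of None \<Rightarrow> partial l (var m) | Some k \<Rightarrow> D k (var m))" for j m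
      have "card (UNIV :: 'n set) < card (UNIV :: 'n option set)"
        by (simp add:)
      then obtain c j where c: "c j \<noteq> 0" "\<And>m. (\<Sum>j\<in>UNIV. c j * v j m) = 0"
        using linear_dependence[of "UNIV :: 'n set" "UNIV :: 'n option set" v] by auto
      have sum: "(\<Sum>j\<in>UNIV. c j * g j) = c None * g None + (\<Sum>k\<in>UNIV. c (Some k) * g (Some k))"
        for g :: "'n option \<Rightarrow> ('k, 'n) mpoly"
        by (simp add: UNIV_option_conv sum.reindex inj_on_def)
      have "(\<lambda>p. c None * partial l p) = (\<lambda>p. \<Sum>k\<in>UNIV. - c (Some k) * D k p)"
      proof (rule Vec_eqI)
        show "c None * partial l (var i) = (\<Sum>k\<in>UNIV. - c (Some k) * D k (var i))" for i
          using c(2)[of i] unfolding sum by (simp add: v_def sum_negf eq_neg_iff_add_eq_0)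
      qed (intro Vec_mult_left Vec_partial Vec_combination D)+
      moreover have "c None \<noteq> 0"
      proof
        assume "c None = 0"
        with fun_cong[OF calculation] have "(\<Sum>k\<in>UNIV. c (Some k) * D k p) = 0" for p
          by (simp add: sum_negf)
        then have "c (Some k) = 0" for k
          using independent_opsD[OF ind, of "\<lambda>k. c (Some k)" "\<lambda>_. 0"] by simp
        with \<open>c None = 0\<close> c(1) show False by (cases j) auto
      qed
      ultimately show ?thesis by (metis (mono_tags))
    qed
    then obtain h c where h: "\<And>l. h l \<noteq> 0" and hc: "\<And>l p. h l * partial l p = (\<Sum>k\<in>UNIV. c l k * D k p)"
      by metis
    define C H :: "('k, 'n) mpoly ^ 'n ^ 'n" where "C = (\<chi> k l. c l k)" and "H = (\<chi> i l. if i = l then h l else 0)"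
    \<comment> \<open>A product of \<open>B\<close> with another matrix is diagonal with nonzero
      diagonal entries, so \<open>det B\<close> is a factor of a nonzero polynomial.\<close>
    have "B ** C = H"
    proof -
      have "(\<Sum>k\<in>UNIV. D k (var i) * c l k) = (if i = l then h l else 0)" for i l
        using hc[of l "var i"] by (auto simp: partial_var mult.commute split: if_splits)
      then show ?thesis by (simp add: matrix_matrix_mult_def vec_eq_iff B C_def H_def)
    qed
    moreover have "det H = (\<Prod>l\<in>UNIV. h l)"
      by (subst det_diagonal) (auto simp: H_def)
    ultimately show ?thesis
      using h by (metis det_mul mpoly_mult_eq_0_iff mpoly_prod_eq_0_iff finite_class.finite_UNIV)
  qed
  ultimately show thesis by (rule that[rotated])
qed

section \<open>Locally nilpotent derivations\<close>

lemma funpow_partial_eq_0: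
  assumes "\<forall>m\<in>Poly_Mapping.keys p. Poly_Mapping.lookup m i < N"
  shows "(partial i ^^ N) p = 0"
  using assms
proof (induction N arbitrary: p)
  case (Suc N)
  have "Poly_Mapping.lookup m i < N" if "m \<in> Poly_Mapping.keys (partial i p)" for m
  proof -
    have "m + Poly_Mapping.single i 1 \<in> Poly_Mapping.keys p"
      using that by (auto simp: in_keys_iff lookup_partial)
    with Suc.prems have "Poly_Mapping.lookup (m + Poly_Mapping.single i 1) i < Suc N" by blast
    then show ?thesis by (simp add: lookup_add)
  qed
  then show ?case
    using Suc.IH by (simp add: funpow_swap1)
qed (auto simp flip: keys_eq_empty)

lemma partial_locally_nilpotent:
  fixes p :: "'a::finite \<Rightarrow> ('k::comm_ring_1, 'n) mpoly"
  shows "\<exists>N. \<forall>a. (partial i ^^ N) (p a) = 0"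
proof -
  let ?X = "\<Union>a. (\<lambda>m. Poly_Mapping.lookup m i) ` Poly_Mapping.keys (p a)"
  have "finite ?X" by simp
  then obtain N where "\<forall>x\<in>?X. x < N" by (meson finite_nat_set_iff_bounded)
  then have "(partial i ^^ N) (p a) = 0" for a
    by (intro funpow_partial_eq_0) auto
  then show ?thesis by blast
qed

text \<open>In the Leibniz expansion of order \<open>a + b\<close>, every term except the one with
  exactly \<open>a\<close> derivatives on \<open>f\<close> has too many derivatives on one of the
  factors.\<close>

lemma Vec_funpow_mult:
  fixes \<delta> :: "('k::comm_ring_1, 'n) operator"
  assumes \<delta>: "\<delta> \<in> Vec" and f: "(\<delta> ^^ Suc a) f = 0" and g: "(\<delta> ^^ Suc b) g = 0"
  shows "(\<delta> ^^ (a + b)) (f * g) = of_nat ((a + b) choose a) * ((\<delta> ^^ a) f * (\<delta> ^^ b) g)"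
proof -
  have pow_0: "(\<delta> ^^ n) 0 = 0" for n
    by (induction n) (simp_all add: VecD(4)[OF \<delta>])
  have pow_add: "(\<delta> ^^ n) (p + q) = (\<delta> ^^ n) p + (\<delta> ^^ n) q" for n p q
    by (induction n) (simp_all add: VecD(1)[OF \<delta>])
  show ?thesis
    using f g
  proof (induction "a + b" arbitrary: a b f g)
    case 0
    then show ?case by simp
  next
    case (Suc n)
    have step: "(\<delta> ^^ (a + b)) (f * g) = (\<delta> ^^ n) (\<delta> f * g) + (\<delta> ^^ n) (f * \<delta> g)"
      unfolding Suc.hyps(2)[symmetric] by (simp add: funpow_swap1 VecD(3)[OF \<delta>] pow_add)
    show ?case
    proof (cases a)
      case 0
      then have "\<delta> f = 0" "b = Suc n" using Suc by simp_all
      moreover have "(\<delta> ^^ (0 + n)) (f * \<delta> g) = of_nat ((0 + n) choose 0) * ((\<delta> ^^ 0) f * (\<delta> ^^ n) (\<delta> g))"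
        using Suc.prems \<open>b = Suc n\<close> 0 by (intro Suc.hyps(1)) (simp_all add: funpow_swap1)
      ultimately show ?thesis
        using 0 step by (simp add: pow_0 funpow_swap1)
    next
      case a: (Suc a')
      show ?thesis
      proof (cases b)
        case 0
        then have "\<delta> g = 0" "a' = n" using Suc a by simp_all
        moreover have "(\<delta> ^^ (n + 0)) (\<delta> f * g) = of_nat ((n + 0) choose n) * ((\<delta> ^^ n) (\<delta> f) * (\<delta> ^^ 0) g)"
          using Suc.prems \<open>a' = n\<close> a 0 by (intro Suc.hyps(1)) (simp_all add: funpow_swap1)
        ultimately show ?thesis
          using 0 a step by (simp add: pow_0 funpow_swap1)
      next
        case b: (Suc b')
        have n: "n = a' + b" "n = a + b'" using Suc.hyps(2) a b by simp_all
        have "(\<delta> ^^ (a' + b)) (\<delta> f * g) = of_nat ((a' + b) choose a') * ((\<delta> ^^ a') (\<delta> f) * (\<delta> ^^ b) g)"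
          using Suc.prems a n by (intro Suc.hyps(1)) (simp_all add: funpow_swap1)
        moreover have "(\<delta> ^^ (a + b')) (f * \<delta> g) = of_nat ((a + b') choose a) * ((\<delta> ^^ a) f * (\<delta> ^^ b') (\<delta> g))"
          using Suc.prems b n by (intro Suc.hyps(1)) (simp_all add: funpow_swap1)
        moreover have "(\<delta> ^^ a') (\<delta> f) = (\<delta> ^^ a) f" "(\<delta> ^^ b') (\<delta> g) = (\<delta> ^^ b) g"
          using a b by (simp_all add: funpow_swap1)
        moreover have "(a + b) choose a = (n choose a') + (n choose a)"
          using Suc.hyps(2) a by (metis binomial_Suc_Suc)
        ultimately show ?thesis
          using step n by (simp add: distrib_right)
      qed
    qed
  qed
qed

lemma locally_nilpotent_order:
  fixes \<delta> :: "('k::comm_ring_1, 'n) operator"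
  assumes "\<exists>N. (\<delta> ^^ N) p = 0" "p \<noteq> 0"
  obtains a where "(\<delta> ^^ a) p \<noteq> 0" "(\<delta> ^^ Suc a) p = 0"
proof -
  obtain N where "(\<delta> ^^ N) p = 0" "\<forall>a<N. (\<delta> ^^ a) p \<noteq> 0"
    using exists_least_iff[of "\<lambda>N. (\<delta> ^^ N) p = 0"] assms(1) by blast
  with assms(2) show thesis
    by (cases N) (auto intro: that)
qed

text \<open>If \<open>f\<close> and \<open>d\<close> vanish only after exactly \<open>a + 1\<close>
  and \<open>b + 1\<close> applications, then \<open>\<delta> ^^ (a + b)\<close> does not kill
  \<open>f * d\<close>, as there are no zero divisors in characteristic zero. But
  \<open>f * d = \<delta> d\<close> already dies after \<open>b\<close> applications.\<close>

lemma locally_nilpotent_eigenvector: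
  fixes \<delta> :: "('k::field_char_0, 'n::finite) operator"
  assumes \<delta>: "\<delta> \<in> Vec" "\<And>p. \<exists>N. (\<delta> ^^ N) p = 0" and d: "\<delta> d = f * d" "d \<noteq> 0"
  shows "f = 0"
proof (rule ccontr)
  assume "f \<noteq> 0"
  then obtain a where a: "(\<delta> ^^ a) f \<noteq> 0" "(\<delta> ^^ Suc a) f = 0"
    using locally_nilpotent_order[OF \<delta>(2)] by blast
  obtain b where b: "(\<delta> ^^ b) d \<noteq> 0" "(\<delta> ^^ Suc b) d = 0"
    using locally_nilpotent_order[OF \<delta>(2) d(2)] by blast
  have pow_0: "(\<delta> ^^ n) 0 = 0" for n
    by (induction n) (simp_all add: VecD(4)[OF \<delta>(1)])
  have "(\<delta> ^^ (a + b)) (f * d) = (\<delta> ^^ a) ((\<delta> ^^ Suc b) d)"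
    unfolding d(1)[symmetric] by (simp add: funpow_add funpow_swap1)
  also have "\<dots> = 0" by (simp only: b(2) pow_0)
  finally have "of_nat ((a + b) choose a) * ((\<delta> ^^ a) f * (\<delta> ^^ b) d) = 0"
    unfolding Vec_funpow_mult[OF \<delta>(1) a(2) b(2)] .
  then show False
    using a(1) b(1) by simp
qed

section \<open>The three Lie algebras of vector fields\<close>

definition fld :: "('k::comm_ring_1, 'n) mpoly \<Rightarrow> 'n \<Rightarrow> ('k, 'n) operator"
  where "fld f k = (\<lambda>p. f * partial k p)"

definition diag_field :: "('n \<Rightarrow> 'k::comm_ring_1) \<Rightarrow> ('k, 'n::finite) operator"
  where "diag_field a = vector_field (\<lambda>i. const (a i) * var i)"

lemma fld_in_Vec: "fld f k \<in> Vec"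
  unfolding fld_def by (intro Vec_mult_left Vec_partial)

lemma fld_var [simp]: "fld f k (var i) = (if k = i then f else 0)"
  by (simp add: fld_def partial_var)

lemma fld_1: "fld 1 k = partial k"
  by (simp add: fld_def)

lemma diag_field_in_Vec: "diag_field a \<in> Vec"
  by (simp add: diag_field_def Vec_eq)

lemma diag_field_var [simp]: "diag_field a (var i) = const (a i) * var i"
  by (simp add: diag_field_def)

lemma divergence_fld: "divergence (fld f k) = partial k f"
  by (simp add: divergence_def if_distrib[of "partial _"] cong: if_cong)

lemma const_sum: "const (\<Sum>a\<in>A. f a) = (\<Sum>a\<in>A. const (f a))"
  by (induction A rule: infinite_finite_induct) (simp_all add: const_add)

lemma divergence_diag_field: "divergence (diag_field a) = const (\<Sum>i\<in>UNIV. a i)"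
  by (simp add: divergence_def partial_var const_sum)

text \<open>The three algebras are treated uniformly. The bound on the dimension excludes
  divergence-free fields on the line: in characteristic zero these are the constant fields, among
  which there is no nonzero diagonal one.\<close>

definition vector_algebra :: "('k::comm_ring_1, 'n::finite) operator set \<Rightarrow> bool"
  where "vector_algebra \<gg> \<longleftrightarrow>
    \<gg> = Vec \<or> \<gg> = Vec_const_div \<or> \<gg> = Vec_zero_div \<and> CARD('n) \<ge> 2"

lemma vector_algebra_lie_subalgebra: "vector_algebra \<gg> \<Longrightarrow> lie_subalgebra \<gg>"
  by (auto simp: vector_algebra_def lie_subalgebra_Vec lie_subalgebra_Vec_const_div
      lie_subalgebra_Vec_zero_div)

lemma vector_algebra_subset:
  assumes "vector_algebra \<gg>"
  shows "\<gg> \<subseteq> Vec" "Vec_zero_div \<subseteq> \<gg>"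
  using assms Vec_zero_div_subset by (auto simp: vector_algebra_def)

lemma fld_in_Vec_zero_div: "partial k f = 0 \<Longrightarrow> fld f k \<in> Vec_zero_div"
  by (simp add: Vec_zero_div_def fld_in_Vec divergence_fld)

lemma partial_in_Vec_zero_div: "partial k \<in> Vec_zero_div"
  using fld_in_Vec_zero_div[of k 1] by (simp add: fld_1)

lemma ex_neq_index:
  fixes i :: "'n::finite"
  assumes "CARD('n) \<ge> 2"
  obtains j where "j \<noteq> i"
proof -
  have "UNIV \<noteq> {i}"
  proof
    assume "UNIV = {i}"
    then have "CARD('n) = card {i}" by (rule arg_cong)
    then show False using assms by simp
  qed
  then show thesis using that by blast
qed

lemma diag_field_nonzero_weights:
  assumes "vector_algebra (\<gg> :: ('k::field_char_0, 'n::finite) operator set)"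
  obtains a where "\<And>i. a i \<noteq> 0" "diag_field a \<in> \<gg>" "\<gg> \<noteq> Vec_zero_div \<Longrightarrow> a = (\<lambda>_. 1)"
proof (cases "\<gg> = Vec \<or> \<gg> = Vec_const_div")
  case True
  then have "diag_field (\<lambda>_. 1) \<in> \<gg>"
    by (auto simp: Vec_const_div_def diag_field_in_Vec divergence_diag_field)
  then show thesis by (intro that[of "\<lambda>_. 1"]) auto
next
  case False
  with assms have n: "CARD('n) \<ge> 2" and \<gg>: "\<gg> = Vec_zero_div"
    by (auto simp: vector_algebra_def)
  obtain i0 :: 'n where True by simp
  \<comment> \<open>The weights have to add up to zero; the exceptional one is nonzero because the
    dimension is at least two.\<close>
  let ?a = "\<lambda>i. if i = i0 then - of_nat (CARD('n) - 1) else 1 :: 'k"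
  have "(\<Sum>i\<in>UNIV. ?a i) = ?a i0 + (\<Sum>i\<in>UNIV - {i0}. ?a i)"
    by (rule sum.remove) auto
  also have "(\<Sum>i\<in>UNIV - {i0}. ?a i) = (\<Sum>i\<in>UNIV - {i0}. 1)"
    by (rule sum.cong) auto
  finally have "(\<Sum>i\<in>UNIV. ?a i) = 0"
    by simp
  then have "diag_field ?a \<in> \<gg>"
    by (simp add: \<gg> Vec_zero_div_def diag_field_in_Vec divergence_diag_field)
  moreover have "?a i \<noteq> 0" for i
    using n by auto
  ultimately show thesis
    using \<gg> by (intro that[of ?a]) auto
qed

lemma bracket_diag_partial:
  fixes a :: "'n::finite \<Rightarrow> 'k::comm_ring_1"
  shows "partial k (diag_field a p) = diag_field a (partial k p) + const (a k) * partial k p"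
proof -
  have "(\<lambda>q. partial k (diag_field a q) - diag_field a (partial k q)) = (\<lambda>p. const (a k) * partial k p)"
  proof (rule Vec_eqI)
    show "(\<lambda>q. partial k (diag_field a q) - diag_field a (partial k q)) \<in> Vec"
      by (intro Vec_bracket Vec_partial diag_field_in_Vec)
    show "partial k (diag_field a (var i)) - diag_field a (partial k (var i)) = const (a k) * partial k (var i)" for i
      by (simp add: partial_var VecD(4)[OF diag_field_in_Vec] Vec_1[OF diag_field_in_Vec])
  qed (intro Vec_mult_left Vec_partial)
  from fun_cong[OF this, of p] show ?thesis by (simp add: algebra_simps)
qed

section \<open>Automorphisms of the Lie algebras of vector fields\<close>

locale vector_algebra_automorphism =
  fixes \<gg> :: "('k::field_char_0, 'n::finite) operator set" and \<theta>
  assumes algebra: "vector_algebra \<gg>" and auto: "\<theta> \<in> lie_auto \<gg>"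
begin

lemma in_Vec: "\<delta> \<in> \<gg> \<Longrightarrow> \<delta> \<in> Vec"
  using vector_algebra_subset[OF algebra] by blast

lemma zero_div_in: "\<delta> \<in> Vec_zero_div \<Longrightarrow> \<delta> \<in> \<gg>"
  using vector_algebra_subset[OF algebra] by blast

lemma bij: "bij_betw \<theta> \<gg> \<gg>"
  using auto by (simp add: lie_auto_def Bij_def)

lemma image_in: "\<delta> \<in> \<gg> \<Longrightarrow> \<theta> \<delta> \<in> \<gg>"
  using bij by (rule bij_betwE[rule_format])

lemma image_in_Vec: "\<delta> \<in> \<gg> \<Longrightarrow> \<theta> \<delta> \<in> Vec"
  by (intro in_Vec image_in)

lemma add_in: "\<delta> \<in> \<gg> \<Longrightarrow> \<epsilon> \<in> \<gg> \<Longrightarrow> (\<lambda>p. \<delta> p + \<epsilon> p) \<in> \<gg>"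
  and scale_in: "\<delta> \<in> \<gg> \<Longrightarrow> (\<lambda>p. const c * \<delta> p) \<in> \<gg>"
  and bracket_in: "\<delta> \<in> \<gg> \<Longrightarrow> \<epsilon> \<in> \<gg> \<Longrightarrow> (\<lambda>p. \<delta> (\<epsilon> p) - \<epsilon> (\<delta> p)) \<in> \<gg>"
  and zero_in: "(\<lambda>p. 0) \<in> \<gg>"
  using vector_algebra_lie_subalgebra[OF algebra]
  unfolding lie_subalgebra_def add_op_def scale_op_def lie_bracket_def by blast+

lemma image_add: "\<delta> \<in> \<gg> \<Longrightarrow> \<epsilon> \<in> \<gg> \<Longrightarrow> \<theta> (\<lambda>p. \<delta> p + \<epsilon> p) = (\<lambda>p. \<theta> \<delta> p + \<theta> \<epsilon> p)"
  and image_scale: "\<delta> \<in> \<gg> \<Longrightarrow> \<theta> (\<lambda>p. const c * \<delta> p) = (\<lambda>p. const c * \<theta> \<delta> p)"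
  and image_bracket: "\<delta> \<in> \<gg> \<Longrightarrow> \<epsilon> \<in> \<gg> \<Longrightarrow>
    \<theta> (\<lambda>p. \<delta> (\<epsilon> p) - \<epsilon> (\<delta> p)) = (\<lambda>p. \<theta> \<delta> (\<theta> \<epsilon> p) - \<theta> \<epsilon> (\<theta> \<delta> p))"
  using auto unfolding lie_auto_def add_op_def scale_op_def lie_bracket_def by blast+

lemma image_zero: "\<theta> (\<lambda>p. 0) = (\<lambda>p. 0)"
  using image_scale[OF zero_in, of 0] by simp

lemma image_nonzero:
  assumes "\<delta> \<in> \<gg>" "\<delta> q \<noteq> 0"
  shows "\<exists>p. \<theta> \<delta> p \<noteq> 0"
proof (rule ccontr)
  assume "\<not> (\<exists>p. \<theta> \<delta> p \<noteq> 0)"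
  then have "\<theta> \<delta> = \<theta> (\<lambda>p. 0)"
    by (auto simp: image_zero)
  then have "\<delta> = (\<lambda>p. 0)"
    using bij assms(1) zero_in by (auto simp: bij_betw_def inj_on_def)
  with assms(2) show False by simp
qed

lemma image_commute:
  assumes "\<delta> \<in> \<gg>" "\<epsilon> \<in> \<gg>" "\<And>p. \<delta> (\<epsilon> p) = \<epsilon> (\<delta> p)"
  shows "\<theta> \<delta> (\<theta> \<epsilon> p) = \<theta> \<epsilon> (\<theta> \<delta> p)"
  using fun_cong[OF image_bracket[OF assms(1,2)], of p] by (simp add: assms(3) image_zero)

lemma partial_in: "partial k \<in> \<gg>"
  by (intro zero_div_in partial_in_Vec_zero_div)

section \<open>The images of the coordinate derivations\<close>

definition D :: "'n \<Rightarrow> ('k, 'n) operator"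
  where "D k = \<theta> (partial k)"

lemma D_Vec: "D k \<in> Vec"
  unfolding D_def by (intro image_in_Vec partial_in)

lemma D_commute: "D k (D l p) = D l (D k p)"
  unfolding D_def by (intro image_commute partial_in partial_commute)

lemma D_nonzero: "\<exists>p. D k p \<noteq> 0"
  unfolding D_def by (rule image_nonzero[OF partial_in, of _ "var k"]) (simp add: partial_var)

lemma bracket_partial_image:
  assumes "\<delta> \<in> \<gg>"
  shows "D k (\<theta> \<delta> p) = \<theta> \<delta> (D k p) + \<theta> (\<lambda>q. partial k (\<delta> q) - \<delta> (partial k q)) p"
  using fun_cong[OF image_bracket[OF partial_in assms], of k p] by (simp add: D_def algebra_simps)

lemma bracket_partial_fld: "partial k (fld f j q) - fld f j (partial k q) = partial k f * partial j q"
  by (simp add: fld_def partial_commute algebra_simps)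

lemma D_image_fld:
  assumes "fld f j \<in> \<gg>"
  shows "D k (\<theta> (fld f j) p) = \<theta> (fld f j) (D k p) + \<theta> (fld (partial k f) j) p"
  unfolding bracket_partial_image[OF assms] bracket_partial_fld by (simp add: fld_def)

lemma image_fld_0: "\<theta> (fld 0 j) p = 0"
  by (simp add: fld_def image_zero)

text \<open>The images of \<open>x_i^2 \<partial>_j\<close> and \<open>x_i \<partial>_j\<close>
  serve as \<open>Q\<close> and \<open>E\<close>. For \<open>i \<noteq> j\<close> both fields have
  divergence zero and so lie in each of the three algebras.\<close>

lemma D_independent: "independent_ops UNIV D"
proof (rule commuting_independent)
  fix i j :: 'n
  assume "i \<noteq> j"
  let ?Q = "fld (var i * var i) j :: ('k, 'n) operator" and ?E = "fld (var i) j :: ('k, 'n) operator"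
  have Q: "?Q \<in> \<gg>" and E: "?E \<in> \<gg>"
    using \<open>i \<noteq> j\<close> by (auto intro!: zero_div_in fld_in_Vec_zero_div simp: partial_var)
  have two: "fld (2 * var i) j = (\<lambda>p. const 2 * ?E p)"
    by (simp add: fld_def const_numeral mult.assoc)
  have "D i (\<theta> ?Q p) = \<theta> ?Q (D i p) + 2 * \<theta> ?E p" for p
    by (simp add: D_image_fld[OF Q] partial_var two image_scale[OF E]) (simp add: const_numeral)
  moreover have "D i (\<theta> ?E p) = \<theta> ?E (D i p) + D j p" for p
    by (simp add: D_image_fld[OF E] partial_var fld_1 flip: D_def)
  moreover have "D k (\<theta> ?Q p) = \<theta> ?Q (D k p)" "D k (\<theta> ?E p) = \<theta> ?E (D k p)" if "k \<noteq> i" for k p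
    using that by (simp_all add: D_image_fld[OF Q] D_image_fld[OF E] partial_var image_fld_0)
  ultimately show "\<exists>Q\<in>Vec. \<exists>E\<in>Vec. (\<forall>p. D i (Q p) = Q (D i p) + 2 * E p) \<and>
      (\<forall>p. D i (E p) = E (D i p) + D j p) \<and>
      (\<forall>k p. k \<noteq> i \<longrightarrow> D k (Q p) = Q (D k p) \<and> D k (E p) = E (D k p))"
    using image_in_Vec[OF Q] image_in_Vec[OF E] by blast
qed (intro D_Vec D_nonzero D_commute)+

text \<open>In \<open>Vec\<close> the multiple \<open>f D m\<close> is the image of some field with
  components \<open>F i\<close>. Bracketing with \<open>partial m\<close> differentiates the
  \<open>F i\<close>, while on the image side it replaces \<open>f\<close> by \<open>D m f\<close>;
  hence local nilpotency of \<open>partial m\<close> carries over.\<close>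

lemma D_locally_nilpotent:
  assumes "\<gg> = Vec"
  shows "\<exists>N. (D m ^^ N) f = 0"
proof -
  have "(\<lambda>p. f * D m p) \<in> \<theta> ` Vec"
    using bij Vec_mult_left[OF D_Vec] by (simp add: assms bij_betw_def)
  then obtain F where F: "\<theta> (vector_field F) = (\<lambda>p. f * D m p)"
    by (auto simp: Vec_eq)
  have "(\<lambda>p. (D m ^^ N) f * D m p) = \<theta> (vector_field (\<lambda>i. (partial m ^^ N) (F i)))" for N
  proof (induction N)
    case 0
    then show ?case by (simp add: F)
  next
    case (Suc N)
    let ?V = "vector_field (\<lambda>i. (partial m ^^ N) (F i))"
    have V: "?V \<in> \<gg>" by (simp add: assms Vec_eq)
    have "(\<lambda>q. partial m (?V q) - ?V (partial m q)) = vector_field (\<lambda>i. (partial m ^^ Suc N) (F i))"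
      by (simp add: vector_field_def partial_commute[of m] sum.distrib fun_eq_iff)
    then have "\<theta> (vector_field (\<lambda>i. (partial m ^^ Suc N) (F i))) p = D m (\<theta> ?V p) - \<theta> ?V (D m p)" for p
      using bracket_partial_image[OF V, of m p] by simp
    also have "\<dots> p = (D m ^^ Suc N) f * D m p" for p
      by (simp add: VecD(3)[OF D_Vec] flip: Suc.IH)
    finally show ?case by auto
  qed
  moreover obtain N where "\<And>i. (partial m ^^ N) (F i) = 0"
    using partial_locally_nilpotent[of m F] by blast
  ultimately have "(\<lambda>p. (D m ^^ N) f * D m p) = \<theta> (\<lambda>p. 0)"
    by (simp add: vector_field_def)
  then have "(D m ^^ N) f * D m p = 0" for p
    unfolding image_zero by (rule fun_cong)
  then show ?thesis using D_nonzero[of m] by auto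
qed

text \<open>On \<open>Vec\<close>, the determinant of the frame is an eigenvector of the locally
  nilpotent \<open>D m\<close> with eigenvalue \<open>divergence (D m)\<close>. On the smaller
  algebras all divergences are constant, and \<open>D m\<close> is the bracket of \<open>D k\<close>
  with the image of \<open>x_k \<partial>_m\<close>; brackets of fields of constant divergence have
  divergence zero.\<close>

lemma D_divergence: "divergence (D m) = 0"
proof (cases "\<gg> = Vec")
  case True
  obtain d where "d \<noteq> 0" "D m d = divergence (D m) * d"
    using commuting_frame[OF D_Vec D_commute D_independent] by metis
  then show ?thesis
    using locally_nilpotent_eigenvector[OF D_Vec D_locally_nilpotent[OF True]] by blast
next
  case False
  then have const: "\<exists>c. divergence \<delta> = const c" if "\<delta> \<in> \<gg>" for \<delta>
    using algebra that const_0[symmetric]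
    by (auto simp: vector_algebra_def Vec_const_div_def Vec_zero_div_def)
  obtain k where k: "fld (var k) m \<in> \<gg>"
  proof (cases "CARD('n) \<ge> 2")
    case True
    then obtain k where "k \<noteq> m" by (rule ex_neq_index)
    then show thesis
      by (intro that[of k] zero_div_in fld_in_Vec_zero_div) (simp add: partial_var)
  next
    \<comment> \<open>In dimension one only \<open>Vec_const_div\<close> remains, and it contains
      the Euler field, so \<open>k = m\<close> is admissible.\<close>
    case n: False
    then have "\<gg> = Vec_const_div"
      using False algebra by (auto simp: vector_algebra_def)
    then show thesis
      by (intro that[of m]) (auto simp: Vec_const_div_def fld_in_Vec divergence_fld partial_var
          intro!: range_eqI[of _ _ 1])
  qed
  have "D m = lie_bracket (D k) (\<theta> (fld (var k) m))"
    by (simp add: lie_bracket_def D_image_fld[OF k] partial_var fld_1 flip: D_def)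
  moreover obtain c c' where "divergence (D k) = const c" "divergence (\<theta> (fld (var k) m)) = const c'"
    using const[OF image_in[OF partial_in]] const[OF image_in[OF k]] by (metis D_def)
  ultimately show ?thesis
    using divergence_lie_bracket[OF D_Vec image_in_Vec[OF k]]
    by (simp add: VecD(6)[OF D_Vec] VecD(6)[OF image_in_Vec[OF k]])
qed

section \<open>Expansion in the frame and dual coordinates\<close>

lemma D_frame:
  obtains b where "\<And>k p. partial k p = (\<Sum>l\<in>UNIV. b k l * D l p)"
proof (rule commuting_frame[OF D_Vec D_commute D_independent])
  fix d :: "('k, 'n) mpoly" and M
  assume d: "d \<noteq> 0" "\<And>m. D m d = divergence (D m) * d"
    and M: "\<And>k p. d * partial k p = (\<Sum>l\<in>UNIV. M k l * D l p)"
  \<comment> \<open>All \<open>D m\<close> annihilate \<open>d\<close> because their divergences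
    vanish, and \<open>d * partial k\<close> is a combination of them. So \<open>d\<close> is a
    nonzero constant and can be divided out.\<close>
  have "d * partial k d = 0" for k
    unfolding M by (simp add: d(2) D_divergence)
  then obtain c where c: "d = const c"
    using partials_0_imp_const[of d] d(1) by auto
  with d(1) have inv: "const (inverse c) * d = 1"
    by (simp flip: const_mult)
  have "partial k p = (\<Sum>l\<in>UNIV. const (inverse c) * M k l * D l p)" for k p
    using arg_cong[OF M, of "\<lambda>x. const (inverse c) * x" k p]
    by (simp add: inv sum_distrib_left flip: mult.assoc)
  then show thesis by (rule that)
qed

lemma D_expansion:
  assumes "\<delta> \<in> Vec"
  obtains f where "\<And>p. \<delta> p = (\<Sum>l\<in>UNIV. f l * D l p)"
proof -
  obtain b where b: "\<And>k p. partial k p = (\<Sum>l\<in>UNIV. b k l * D l p)"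
    using D_frame by blast
  have "\<delta> p = (\<Sum>l\<in>UNIV. (\<Sum>i\<in>UNIV. \<delta> (var i) * b i l) * D l p)" for p
  proof -
    have "\<delta> p = (\<Sum>i\<in>UNIV. \<Sum>l\<in>UNIV. \<delta> (var i) * b i l * D l p)"
      unfolding Vec_expand[OF assms, of p] b by (simp add: sum_distrib_left mult.assoc)
    also have "\<dots> = (\<Sum>l\<in>UNIV. \<Sum>i\<in>UNIV. \<delta> (var i) * b i l * D l p)"
      by (rule sum.swap)
    finally show ?thesis by (simp add: sum_distrib_right)
  qed
  then show thesis by (rule that)
qed

lemma D_coordinates:
  fixes y :: "'n \<Rightarrow> ('k, 'n) mpoly"
  assumes y: "\<And>k l. D k (y l) = (if k = l then 1 else 0)" and \<delta>: "\<delta> \<in> Vec"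
  shows "\<delta> p = (\<Sum>l\<in>UNIV. \<delta> (y l) * D l p)"
proof -
  obtain f where f: "\<And>p. \<delta> p = (\<Sum>l\<in>UNIV. f l * D l p)"
    using D_expansion[OF \<delta>] by blast
  have "\<delta> (y l) = f l" for l
    unfolding f[of "y l"] y by (simp add: if_distrib[of "\<lambda>x. _ * x"] cong: if_cong)
  then show ?thesis using f[of p] by simp
qed

lemma dual_coordinates:
  assumes a: "\<And>i. a i \<noteq> 0" and h: "diag_field a \<in> \<gg>"
  obtains y where "\<And>k l. D k (y l) = (if k = l then 1 else 0)"
    "\<And>l. \<theta> (diag_field a) (y l) = const (a l) * y l"
proof -
  let ?h = "\<theta> (diag_field a)"
  obtain f where f: "\<And>p. ?h p = (\<Sum>l\<in>UNIV. f l * D l p)"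
    using D_expansion[OF image_in_Vec[OF h]] by blast
  define y where "y l = const (inverse (a l)) * f l" for l
  \<comment> \<open>The bracket of \<open>D k\<close> with \<open>?h\<close> is the image of
    \<open>a_k \<partial>_k\<close>, that is \<open>a_k D k\<close>; its coefficients in the frame
    are the \<open>D k (f l)\<close>.\<close>
  have Df: "D k (f l) = (if l = k then const (a k) else 0)" for k l
  proof (rule independent_opsD[OF D_independent _ UNIV_I, where c = "\<lambda>l. D k (f l)"])
    fix p
    have "(\<Sum>l\<in>UNIV. D k (f l) * D l p) = D k (?h p) - ?h (D k p)"
      unfolding f by (simp add: Vec_sum[OF D_Vec] VecD(3)[OF D_Vec] sum.distrib D_commute[of k])
    also have "\<dots> = const (a k) * D k p"
      using bracket_partial_image[OF h, of k p]
      by (simp add: bracket_diag_partial image_scale[OF partial_in] D_def)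
    finally show "(\<Sum>l\<in>UNIV. D k (f l) * D l p) = (\<Sum>l\<in>UNIV. (if l = k then const (a k) else 0) * D l p)"
      by (simp add: if_distrib[of "\<lambda>x. x * _"] cong: if_cong)
  qed
  have inv: "const (inverse (a k)) * const (a k) = 1" for k
    using a[of k] by (simp flip: const_mult)
  have Dy: "D k (y l) = (if k = l then 1 else 0)" for k l
    by (simp add: y_def VecD(2)[OF D_Vec] Df inv)
  have "?h (y l) = f l" for l
    unfolding f[of "y l"] Dy by (simp add: if_distrib[of "\<lambda>x. _ * x"] cong: if_cong)
  moreover have "f l = const (a l) * y l" for l
    unfolding y_def mult.assoc[symmetric] mult.commute[of "const (a l)"] inv by simp
  ultimately show thesis
    using Dy by (intro that[of y]) auto
qed

end

section \<open>Coordinates adapted to an automorphism\<close>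

definition monom_degree :: "('n::finite \<Rightarrow>\<^sub>0 nat) \<Rightarrow> nat"
  where "monom_degree m = (\<Sum>i\<in>UNIV. Poly_Mapping.lookup m i)"

text \<open>With a strict bound, \<open>N = 0\<close> means \<open>p = 0\<close>, so the induction
  on \<open>N\<close> starts without a convention for the degree of zero.\<close>

definition degree_less :: "nat \<Rightarrow> ('k::zero, 'n::finite) mpoly \<Rightarrow> bool"
  where "degree_less N p \<longleftrightarrow> (\<forall>m\<in>Poly_Mapping.keys p. monom_degree m < N)"

lemma monom_degree_add_single: "monom_degree (m + Poly_Mapping.single i 1) = Suc (monom_degree m)"
  by (simp add: monom_degree_def lookup_add sum.distrib lookup_single when_def)

lemma degree_less_0 [simp]: "degree_less 0 p \<longleftrightarrow> p = 0"
  by (simp add: degree_less_def)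

lemma degree_less_partial:
  assumes "degree_less (Suc N) p"
  shows "degree_less N (partial k p)"
  unfolding degree_less_def
proof
  fix m assume "m \<in> Poly_Mapping.keys (partial k p)"
  then have "m + Poly_Mapping.single k 1 \<in> Poly_Mapping.keys p"
    by (auto simp: in_keys_iff lookup_partial)
  then have "monom_degree (m + Poly_Mapping.single k 1) < Suc N"
    using assms by (auto simp: degree_less_def)
  then show "monom_degree m < N"
    by (simp only: monom_degree_add_single)
qed

lemma ex_degree_less:
  fixes p :: "'a::finite \<Rightarrow> ('k::comm_ring_1, 'n::finite) mpoly"
  shows "\<exists>N. \<forall>a. degree_less N (p a)"
proof -
  have "finite (\<Union>a. monom_degree ` Poly_Mapping.keys (p a))" by simp
  then obtain N where "\<forall>x\<in>(\<Union>a. monom_degree ` Poly_Mapping.keys (p a)). x < N"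
    by (meson finite_nat_set_iff_bounded)
  then show ?thesis by (auto simp: degree_less_def)
qed

lemma var_mult_partial_single:
  fixes m :: "'n::finite \<Rightarrow>\<^sub>0 nat"
  shows "var i * partial i (Poly_Mapping.single m a) =
    Poly_Mapping.single m (of_nat (Poly_Mapping.lookup m i) * a)"
  unfolding partial_single
  using single_eq_var_mult[of m i "of_nat (Poly_Mapping.lookup m i) * a"]
  by (cases "Poly_Mapping.lookup m i = 0") auto

lemma diag_field_single:
  fixes m :: "'n::finite \<Rightarrow>\<^sub>0 nat"
  shows "diag_field e (Poly_Mapping.single m a) =
    const (\<Sum>i\<in>UNIV. e i * of_nat (Poly_Mapping.lookup m i)) * Poly_Mapping.single m a"
  unfolding diag_field_def vector_field_def mult.assoc var_mult_partial_single
  by (simp add: const_sum sum_distrib_right) (simp add: const_def mult_single mult.assoc)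

lemma of_nat_mult_single:
  "of_nat k * Poly_Mapping.single m (x :: 'k::comm_ring_1) = Poly_Mapping.single m (of_nat k * x)"
  by (induction k) (simp_all add: distrib_right single_add)

lemma diag_field_const_weight:
  fixes p :: "('k::comm_ring_1, 'n::finite) mpoly"
  shows "diag_field (\<lambda>_. 1) p =
    (\<Sum>m\<in>Poly_Mapping.keys p. of_nat (monom_degree m) * Poly_Mapping.single m (Poly_Mapping.lookup p m))"
proof -
  have "diag_field (\<lambda>_. 1) p =
      (\<Sum>m\<in>Poly_Mapping.keys p. diag_field (\<lambda>_. 1) (Poly_Mapping.single m (Poly_Mapping.lookup p m)))"
    by (subst (1) mpoly_expand[of p]) (rule Vec_sum[OF diag_field_in_Vec])
  then show ?thesis
    by (simp add: diag_field_single monom_degree_def const_of_nat flip: of_nat_sum)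
qed

text \<open>The Euler field multiplies the part of degree \<open>d\<close> by \<open>d\<close>, so
  the difference loses exactly its part of degree \<open>N\<close>.\<close>

lemma degree_less_euler:
  assumes "degree_less (Suc N) p"
  shows "degree_less N (diag_field (\<lambda>_. 1) p - of_nat N * p)"
  unfolding degree_less_def
proof
  let ?q = "diag_field (\<lambda>_. 1) p - of_nat N * p"
  fix m assume m: "m \<in> Poly_Mapping.keys ?q"
  have "of_nat N * p = (\<Sum>m\<in>Poly_Mapping.keys p. of_nat N * Poly_Mapping.single m (Poly_Mapping.lookup p m))"
    by (subst (1) mpoly_expand[of p]) (rule sum_distrib_left)
  then have "?q = (\<Sum>m\<in>Poly_Mapping.keys p.
      Poly_Mapping.single m ((of_nat (monom_degree m) - of_nat N) * Poly_Mapping.lookup p m))"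
    by (simp add: diag_field_const_weight of_nat_mult_single left_diff_distrib single_diff sum_subtractf)
  then have "Poly_Mapping.lookup ?q m = (\<Sum>m'\<in>Poly_Mapping.keys p.
      if m' = m then (of_nat (monom_degree m) - of_nat N) * Poly_Mapping.lookup p m else 0)"
    by (auto simp: lookup_sum lookup_single when_def intro!: sum.cong)
  with m have "m \<in> Poly_Mapping.keys p" "monom_degree m \<noteq> N"
    by (auto simp: in_keys_iff split: if_splits)
  with assms show "monom_degree m < N"
    by (auto simp: degree_less_def less_Suc_eq)
qed

locale automorphism_coordinates = vector_algebra_automorphism \<gg> \<theta>
  for \<gg> :: "('k::field_char_0, 'n::finite) operator set" and \<theta> +
  fixes a :: "'n \<Rightarrow> 'k" and y :: "'n \<Rightarrow> ('k, 'n) mpoly"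
  assumes weights: "\<And>i. a i \<noteq> 0" and diag_in: "diag_field a \<in> \<gg>"
    and unit_weights: "\<gg> \<noteq> Vec_zero_div \<Longrightarrow> a = (\<lambda>_. 1)"
    and dual: "\<And>k l. D k (y l) = (if k = l then 1 else 0)"
    and diag_image: "\<And>l. \<theta> (diag_field a) (y l) = const (a l) * y l"
begin

section \<open>The fields intertwined by the substitution\<close>

definition Y :: "('k, 'n) mpoly \<Rightarrow> ('k, 'n) mpoly"
  where "Y = comorphism (poly_map y)"

lemma Y_hom: "Y (p + q) = Y p + Y q" "Y (p * q) = Y p * Y q" "Y (p - q) = Y p - Y q"
  "Y (const c) = const c" "Y 0 = 0" "Y 1 = 1" "Y (var i) = y i"
  unfolding Y_def
  by (simp_all add: comorphism_add comorphism_mult comorphism_diff comorphism_const comorphism_0 comorphism_1)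

definition W :: "('k, 'n) operator set"
  where "W = {\<delta> \<in> \<gg>. \<forall>f. \<theta> \<delta> (Y f) = Y (\<delta> f)}"

lemma W_D: "\<delta> \<in> W \<Longrightarrow> \<delta> \<in> \<gg>" "\<delta> \<in> W \<Longrightarrow> \<theta> \<delta> (Y f) = Y (\<delta> f)"
  by (auto simp: W_def)

lemma W_y: "\<delta> \<in> W \<Longrightarrow> \<theta> \<delta> (y l) = Y (\<delta> (var l))"
  using W_D(2)[of \<delta> "var l"] by (simp add: Y_hom)

text \<open>Both \<open>\<theta> \<delta> \<circ> Y\<close> and \<open>Y \<circ> \<delta>\<close>
  are derivations along the homomorphism \<open>Y\<close>, hence determined by their values on the
  variables.\<close>

lemma W_I:
  assumes \<delta>: "\<delta> \<in> \<gg>" and y: "\<And>l. \<theta> \<delta> (y l) = Y (\<delta> (var l))"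
  shows "\<delta> \<in> W"
proof -
  note V = VecD[OF in_Vec[OF \<delta>]] VecD[OF image_in_Vec[OF \<delta>]]
  have "\<theta> \<delta> (Y f) = Y (\<delta> f)" for f
  proof (induction f rule: mpoly_induct)
    case (const c)
    show ?case by (simp add: V Y_hom)
  next
    case (var i q)
    then show ?case by (simp add: V(3,9) Y_hom y)
  next
    case (add p q)
    then show ?case by (simp add: V(1,7) Y_hom)
  qed
  with \<delta> show ?thesis by (simp add: W_def)
qed

lemma W_add: "\<delta> \<in> W \<Longrightarrow> \<epsilon> \<in> W \<Longrightarrow> (\<lambda>p. \<delta> p + \<epsilon> p) \<in> W"
  by (auto simp: W_def add_in image_add Y_hom)

lemma W_scale: "\<delta> \<in> W \<Longrightarrow> (\<lambda>p. const c * \<delta> p) \<in> W"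
  by (auto simp: W_def scale_in image_scale Y_hom)

lemma W_zero: "(\<lambda>p. 0) \<in> W"
  by (auto simp: W_def zero_in image_zero Y_hom)

lemma W_bracket: "\<delta> \<in> W \<Longrightarrow> \<epsilon> \<in> W \<Longrightarrow> (\<lambda>p. \<delta> (\<epsilon> p) - \<epsilon> (\<delta> p)) \<in> W"
  by (auto simp: W_def bracket_in image_bracket Y_hom)

lemma W_sum: "(\<And>s. s \<in> S \<Longrightarrow> \<delta> s \<in> W) \<Longrightarrow> (\<lambda>p. \<Sum>s\<in>S. \<delta> s p) \<in> W"
  by (induction S rule: infinite_finite_induct) (auto intro!: W_add W_zero)

lemma partial_W: "partial k \<in> W"
  by (rule W_I) (auto simp: partial_in partial_var Y_hom dual simp flip: D_def)

lemma D_Y: "D k (Y f) = Y (partial k f)"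
  using W_D(2)[OF partial_W] by (simp add: D_def)

lemma diag_W: "diag_field a \<in> W"
  by (rule W_I) (auto simp: diag_in diag_image Y_hom)

section \<open>Constant defects and their weights\<close>

lemma D_0_imp_const:
  assumes "\<And>k. D k p = 0"
  obtains c where "p = const c"
proof -
  obtain b where b: "\<And>k p. partial k p = (\<Sum>l\<in>UNIV. b k l * D l p)"
    using D_frame by blast
  have "partial k p = 0" for k by (simp add: b assms)
  then show thesis using partials_0_imp_const that by blast
qed

text \<open>The brackets with the coordinate derivations being in \<open>W\<close>, every
  \<open>D k\<close> annihilates the defect
  \<open>\<theta> \<delta> (y l) - Y (\<delta> (var l))\<close>. The \<open>D k\<close> span the
  \<open>partial k\<close>, so the defect is constant. This is the inductive step by which
  membership in \<open>W\<close> is lifted to higher degree.\<close>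

lemma defect_const:
  assumes \<delta>: "\<delta> \<in> \<gg>" and br: "\<And>k. (\<lambda>q. partial k (\<delta> q) - \<delta> (partial k q)) \<in> W"
  obtains c where "\<And>l. \<theta> \<delta> (y l) = Y (\<delta> (var l)) + const (c l)"
proof -
  have "\<exists>c. \<theta> \<delta> (y l) - Y (\<delta> (var l)) = const c" for l
  proof -
    have "D k (\<theta> \<delta> (y l) - Y (\<delta> (var l))) = 0" for k
    proof -
      have "\<theta> \<delta> (D k (y l)) = 0" "\<delta> (partial k (var l)) = 0"
        using \<delta> by (auto simp: dual partial_var Vec_1 in_Vec image_in_Vec VecD(4))
      moreover have "D k (\<theta> \<delta> (y l)) = \<theta> \<delta> (D k (y l)) + Y (partial k (\<delta> (var l)) - \<delta> (partial k (var l)))"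
        using bracket_partial_image[OF \<delta>, of k "y l"] W_y[OF br, of k l] by simp
      ultimately show ?thesis
        by (simp add: VecD(5)[OF D_Vec] D_Y)
    qed
    then show ?thesis using D_0_imp_const by blast
  qed
  then obtain c where "\<And>l. \<theta> \<delta> (y l) - Y (\<delta> (var l)) = const (c l)" by metis
  then show thesis by (intro that[of c]) (simp add: algebra_simps)
qed

text \<open>
  The defect \<open>\<Sum> c\<^sub>l D\<^sub>l\<close> of \<open>\<delta>\<close> has weight \<open>w\<close> if \<open>\<delta>\<close> has weight \<open>w\<close> up to fields in \<open>W\<close>,
  but \<open>D\<^sub>l\<close> has weight \<open>- e\<^sub>l\<close>.
\<close>

lemma defect_weight:
  assumes \<delta>: "\<delta> \<in> \<gg>" and c: "\<And>l. \<theta> \<delta> (y l) = Y (\<delta> (var l)) + const (c l)"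
    and e: "diag_field e \<in> W" and \<rho>: "\<rho> \<in> W"
    and br: "\<And>p. diag_field e (\<delta> p) - \<delta> (diag_field e p) = const w * \<delta> p + \<rho> p"
  shows "(w + e l) * c l = 0"
proof -
  let ?e = "diag_field e"
  have ey: "\<theta> ?e (y l) = const (e l) * y l"
    using W_y[OF e, of l] by (simp add: Y_hom)
  \<comment> \<open>The image of the bracket is evaluated at \<open>y l\<close> in two ways. The
    field \<open>\<theta> ?e\<close> kills the constant \<open>c l\<close>, so the defect
    contributes \<open>w * c l\<close> on one side and \<open>- e l * c l\<close> on the other; all
    other terms cancel.\<close>
  have "\<theta> (\<lambda>p. const w * \<delta> p + \<rho> p) (y l) = const w * \<theta> \<delta> (y l) + Y (\<rho> (var l))"
    by (simp add: image_add[OF scale_in[OF \<delta>] W_D(1)[OF \<rho>]] image_scale[OF \<delta>] W_y[OF \<rho>])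
  moreover have "\<theta> (\<lambda>p. const w * \<delta> p + \<rho> p) (y l) = \<theta> ?e (\<theta> \<delta> (y l)) - \<theta> \<delta> (\<theta> ?e (y l))"
    using fun_cong[OF image_bracket[OF W_D(1)[OF e] \<delta>], of "y l"] by (simp add: br)
  moreover have "\<theta> ?e (\<theta> \<delta> (y l)) = Y (?e (\<delta> (var l)))"
    using VecD[OF image_in_Vec[OF W_D(1)[OF e]]] by (simp add: c W_D(2)[OF e])
  moreover have "\<theta> \<delta> (\<theta> ?e (y l)) = const (e l) * \<theta> \<delta> (y l)"
    using VecD(2)[OF image_in_Vec[OF \<delta>]] by (simp add: ey)
  moreover have "Y (?e (\<delta> (var l))) - const (e l) * Y (\<delta> (var l)) = const w * Y (\<delta> (var l)) + Y (\<rho> (var l))"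
    using arg_cong[OF br[of "var l"], of Y] by (simp add: Y_hom VecD(2)[OF in_Vec[OF \<delta>]])
  ultimately have "const w * (Y (\<delta> (var l)) + const (c l)) + Y (\<rho> (var l))
      = const w * Y (\<delta> (var l)) + Y (\<rho> (var l)) - const (e l) * const (c l)"
    by (simp add: c algebra_simps)
  then have "const w * const (c l) + const (e l) * const (c l) = (0 :: ('k, 'n) mpoly)"
    by (simp add: algebra_simps)
  then have "const ((w + e l) * c l) = (0 :: ('k, 'n) mpoly)"
    by (simp add: const_add const_mult distrib_right)
  then show ?thesis by (simp only: const_eq_0_iff)
qed

end

lemma bracket_diag_fld_single:
  fixes m :: "'n::finite \<Rightarrow>\<^sub>0 nat" and x :: "'k::comm_ring_1"
  defines "s \<equiv> Poly_Mapping.single m x"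
  shows "diag_field e (fld s b p) - fld s b (diag_field e p) =
    const ((\<Sum>i\<in>UNIV. e i * of_nat (Poly_Mapping.lookup m i)) - e b) * fld s b p"
  unfolding fld_def
  by (simp add: VecD(3)[OF diag_field_in_Vec] bracket_diag_partial)
    (simp add: s_def diag_field_single algebra_simps flip: const_diff)

lemma divergence_mult_left:
  fixes \<delta> :: "('k::comm_ring_1, 'n::finite) operator"
  assumes "\<delta> \<in> Vec"
  shows "divergence (\<lambda>p. f * \<delta> p) = \<delta> f + f * divergence \<delta>"
  unfolding divergence_def Vec_expand[OF assms, of f]
  by (simp add: sum.distrib sum_distrib_left mult.commute)

lemma divergence_sum: "divergence (\<lambda>p. \<Sum>s\<in>S. \<delta> s p) = (\<Sum>s\<in>S. divergence (\<delta> s))"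
  unfolding divergence_def partial_sum by (rule sum.swap)

section \<open>The intertwined fields exhaust the algebra\<close>

context automorphism_coordinates
begin

text \<open>Brackets with the \<open>partial k\<close> lower the degree, so by induction the defect
  is constant. A field with components of degree \<open>N\<close> has weight \<open>N - 1\<close>
  for the Euler field up to lower terms, while the \<open>D l\<close> have weight
  \<open>- 1\<close>; comparison gives \<open>N * c l = 0\<close>.\<close>

lemma W_if_degree_less:
  assumes "\<gg> \<noteq> Vec_zero_div" "\<delta> \<in> \<gg>" "\<And>l. degree_less N (\<delta> (var l))"
  shows "\<delta> \<in> W"
  using assms(2,3)
proof (induction N arbitrary: \<delta>)
  case 0
  then have "\<delta> = (\<lambda>p. 0)"
    by (intro Vec_eqI in_Vec zero_in) auto
  then show ?case by (simp add: W_zero)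
next
  case (Suc N)
  note V = VecD[OF in_Vec[OF Suc.prems(1)]]
  show ?case
  proof (cases "N = 0")
    \<comment> \<open>Constant fields need a separate argument: for \<open>N = 0\<close> the two
      weights coincide.\<close>
    case True
    then have "partial k (\<delta> (var l)) = 0" for k l
      using degree_less_partial[OF Suc.prems(2)] by simp
    then have "\<exists>u. \<delta> (var l) = const u" for l
      using partials_0_imp_const by blast
    then obtain u where u: "\<And>l. \<delta> (var l) = const (u l)" by metis
    have "\<delta> = (\<lambda>p. \<Sum>l\<in>UNIV. const (u l) * partial l p)"
      unfolding u[symmetric] by (rule ext) (rule Vec_expand[OF in_Vec[OF Suc.prems(1)]])
    also have "\<dots> \<in> W"
      by (intro W_sum W_scale partial_W)
    finally show ?thesis .
  next
    case False
    have "(\<lambda>q. partial k (\<delta> q) - \<delta> (partial k q)) \<in> W" for k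
    proof (rule Suc.IH)
      show "degree_less N (partial k (\<delta> (var l)) - \<delta> (partial k (var l)))" for l
        using degree_less_partial[OF Suc.prems(2)]
        by (simp add: partial_var V(4) Vec_1[OF in_Vec[OF Suc.prems(1)]])
    qed (intro bracket_in partial_in Suc.prems)
    then obtain c where c: "\<And>l. \<theta> \<delta> (y l) = Y (\<delta> (var l)) + const (c l)"
      using defect_const[OF Suc.prems(1)] by blast
    \<comment> \<open>The bracket with the Euler field is \<open>N - 1\<close> times
      \<open>\<delta>\<close> plus \<open>\<rho>\<close>; the top-degree parts cancel in
      \<open>\<rho>\<close>, so the induction hypothesis applies to it.\<close>
    define \<rho> where "\<rho> p = (diag_field a (\<delta> p) - \<delta> (diag_field a p)) + const (1 - of_nat N) * \<delta> p" for p
    have a: "a = (\<lambda>_. 1)" by (rule unit_weights[OF assms(1)])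
    have "\<rho> \<in> W"
    proof (rule Suc.IH)
      show "\<rho> \<in> \<gg>"
        unfolding \<rho>_def by (intro add_in scale_in bracket_in diag_in Suc.prems)
      have "\<rho> (var l) = diag_field (\<lambda>_. 1) (\<delta> (var l)) - of_nat N * \<delta> (var l)" for l
        by (simp add: \<rho>_def a const_of_nat left_diff_distrib flip: const_diff)
      then show "degree_less N (\<rho> (var l))" for l
        using degree_less_euler[OF Suc.prems(2)] by simp
    qed
    then have "((of_nat N - 1) + a l) * c l = 0" for l
      by (rule defect_weight[OF Suc.prems(1) c diag_W])
        (simp add: \<rho>_def left_diff_distrib flip: const_diff)
    then have "c l = 0" for l
      using False by (simp add: a)
    then show ?thesis
      by (intro W_I Suc.prems) (simp add: c)
  qed
qed

text \<open>Diagonal fields commute, so the field has weight zero for \<open>diag_field a\<close>,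
  while the weights \<open>- a l\<close> of the \<open>D l\<close> are nonzero. Thus no constant
  defect can occur.\<close>

lemma diag_in_W:
  assumes "diag_field e \<in> \<gg>"
  shows "diag_field e \<in> W"
proof -
  have "(\<lambda>q. partial k (diag_field e q) - diag_field e (partial k q)) \<in> W" for k
    by (simp add: bracket_diag_partial W_scale partial_W)
  then obtain c where c: "\<And>l. \<theta> (diag_field e) (y l) = Y (diag_field e (var l)) + const (c l)"
    using defect_const[OF assms] by blast
  have "(\<lambda>p. diag_field a (diag_field e p) - diag_field e (diag_field a p)) = (\<lambda>p. 0)"
    by (rule Vec_eqI[OF Vec_bracket[OF diag_field_in_Vec diag_field_in_Vec] Vec_zero])
      (simp add: VecD(2)[OF diag_field_in_Vec])
  then have "(0 + a l) * c l = 0" for l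
    by (intro defect_weight[OF assms c diag_W W_zero]) (simp add: fun_eq_iff)
  then have "c l = 0" for l
    using weights by simp
  then show ?thesis
    by (intro W_I assms) (simp add: c)
qed

text \<open>By induction on the degree the defect is constant. All diagonal fields of trace zero lie
  in \<open>W\<close>, so a nonzero \<open>c l\<close> would make \<open>m - e_b + e_l\<close> a
  multiple of the all-ones vector. For \<open>l = b\<close> this forces \<open>m = 0\<close>; for
  \<open>l \<noteq> b\<close> the entries at \<open>l\<close> and \<open>b\<close> differ by
  \<open>m_l + 2\<close>.\<close>

lemma monomial_fld_W:
  assumes "Poly_Mapping.lookup m b = 0"
  shows "fld (Poly_Mapping.single m x) b \<in> W"
  using assms
proof (induction "monom_degree m" arbitrary: m x rule: less_induct)
  case less
  let ?f = "fld (Poly_Mapping.single m x) b"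
  have f: "?f \<in> \<gg>"
    by (intro zero_div_in fld_in_Vec_zero_div) (simp add: partial_single less.prems)
  show ?case
  proof (cases "m = 0")
    case True
    then have "?f = (\<lambda>p. const x * partial b p)"
      by (simp add: fld_def const_def)
    then show ?thesis by (simp add: W_scale partial_W)
  next
    case False
    have "(\<lambda>q. partial k (?f q) - ?f (partial k q)) \<in> W" for k
    proof -
      have eq: "(\<lambda>q. partial k (?f q) - ?f (partial k q)) = fld (partial k (Poly_Mapping.single m x)) b"
        unfolding bracket_partial_fld by (simp add: fld_def)
      show ?thesis
      proof (cases "Poly_Mapping.lookup m k = 0")
        case True
        then show ?thesis
          unfolding eq partial_single by (simp add: fld_def W_zero)
      next
        case k: False
        then have "m - Poly_Mapping.single k 1 + Poly_Mapping.single k 1 = m"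
          by (intro poly_mapping_eqI) (auto simp: lookup_add lookup_minus lookup_single when_def)
        then have "monom_degree (m - Poly_Mapping.single k 1) < monom_degree m"
          by (metis monom_degree_add_single lessI)
        then show ?thesis
          unfolding eq partial_single by (intro less.hyps) (simp_all add: lookup_minus less.prems)
      qed
    qed
    then obtain c where c: "\<And>l. \<theta> ?f (y l) = Y (?f (var l)) + const (c l)"
      using defect_const[OF f] by blast
    have eq: "(of_nat (Poly_Mapping.lookup m i) - of_nat (Poly_Mapping.lookup m j)
        - (of_bool (b = i) - of_bool (b = j)) + (of_bool (l = i) - of_bool (l = j))) * c l = 0" for i j l
    proof -
      define e :: "'n \<Rightarrow> 'k" where "e l = of_bool (l = i) - of_bool (l = j)" for l
      have "(\<Sum>l\<in>UNIV. e l * g l) = g i - g j" for g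
        by (simp add: e_def left_diff_distrib sum_subtractf of_bool_def if_distrib[of "\<lambda>x. x * _"] cong: if_cong)
      note e_sum = this this[of "\<lambda>_. 1"]
      have "diag_field e \<in> W"
        using e_sum(2)
        by (intro diag_in_W zero_div_in) (simp add: Vec_zero_div_def diag_field_in_Vec divergence_diag_field)
      from defect_weight[OF f c this W_zero]
      show ?thesis
        unfolding bracket_diag_fld_single e_sum by (simp add: e_def)
    qed
    have "c l = 0" for l
    proof (rule ccontr)
      assume "c l \<noteq> 0"
      with eq[where l = l] have cl: "(of_nat (Poly_Mapping.lookup m i) - of_nat (Poly_Mapping.lookup m j)
        - (of_bool (b = i) - of_bool (b = j)) + (of_bool (l = i) - of_bool (l = j)) :: 'k) = 0" for i j
        by simp
      show False
      proof (cases "l = b")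
        case True
        have "Poly_Mapping.lookup m i = 0" for i
          using cl[of i b] less.prems True by (cases "i = b") auto
        then show False using False by (metis lookup_zero poly_mapping_eqI)
      next
        case False
        have "(of_nat (Poly_Mapping.lookup m l + 2) :: 'k) = 0"
          using cl[of l b] less.prems False by (simp add: algebra_simps)
        then show False by (simp only: of_nat_eq_0_iff)
      qed
    qed
    then show ?thesis
      by (intro W_I f) (simp add: c)
  qed
qed

text \<open>
  For a monomial \<open>u x\<^sub>j\<^sup>d\<close> with \<open>u\<close> free of \<open>x\<^sub>j\<close>, the bracket of \<open>u \<partial>\<^sub>j\<close> and \<open>x\<^sub>j\<^sup>d\<^sup>+\<^sup>1 \<partial>\<^sub>i\<close>
  has the \<open>i\<close>-th component \<open>(d + 1) u x\<^sub>j\<^sup>d\<close>.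
\<close>

lemma two_component_field:
  assumes "i \<noteq> j"
  shows "\<exists>\<epsilon>\<in>W. \<epsilon> (var i) = p \<and> (\<forall>l. l \<noteq> i \<longrightarrow> l \<noteq> j \<longrightarrow> \<epsilon> (var l) = 0)"
proof (induction p rule: mpoly_add_induct)
  case 1
  show ?case by (rule bexI[OF _ W_zero]) simp
next
  case (2 m x)
  let ?e = "\<lambda>d. Poly_Mapping.single j d :: 'n \<Rightarrow>\<^sub>0 nat"
  let ?mj = "Poly_Mapping.lookup m j"
  let ?u = "Poly_Mapping.single (m - ?e ?mj) 1 :: ('k, 'n) mpoly"
  \<comment> \<open>The coefficient is chosen to cancel the factor \<open>of_nat (Suc ?mj)\<close>
    produced by \<open>partial j\<close>.\<close>
  let ?v = "Poly_Mapping.single (?e (Suc ?mj)) (x / of_nat (Suc ?mj))"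
  let ?\<epsilon> = "\<lambda>p. fld ?u j (fld ?v i p) - fld ?v i (fld ?u j p)"
  have "?\<epsilon> \<in> W"
    using assms by (intro W_bracket monomial_fld_W) (simp_all add: lookup_minus lookup_single when_def)
  moreover have "?\<epsilon> (var i) = Poly_Mapping.single m x"
  proof -
    have "m - ?e ?mj + ?e ?mj = m"
      by (rule poly_mapping_eqI) (auto simp: lookup_add lookup_minus lookup_single when_def)
    moreover have "?e (Suc ?mj) - ?e 1 = ?e ?mj"
      by (simp flip: single_diff)
    moreover have "(of_nat (Suc ?mj) :: 'k) \<noteq> 0"
      by (simp only: of_nat_eq_0_iff)
    ultimately have "?u * partial j ?v = Poly_Mapping.single m x"
      by (simp add: partial_single mult_single del: of_nat_Suc)
    then show ?thesis
      using assms by (simp add: fld_def partial_var Vec_1[OF Vec_partial])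
  qed
  moreover have "?\<epsilon> (var l) = 0" if "l \<noteq> i" "l \<noteq> j" for l
    using that by (simp add: fld_def partial_var)
  ultimately show ?case by (intro bexI[of _ ?\<epsilon>]) auto
next
  case (3 p q)
  then obtain \<epsilon> \<eta> where "\<epsilon> \<in> W" "\<epsilon> (var i) = p" "\<forall>l. l \<noteq> i \<longrightarrow> l \<noteq> j \<longrightarrow> \<epsilon> (var l) = 0"
    "\<eta> \<in> W" "\<eta> (var i) = q" "\<forall>l. l \<noteq> i \<longrightarrow> l \<noteq> j \<longrightarrow> \<eta> (var l) = 0"
    by blast
  then show ?case by (intro bexI[OF _ W_add[of \<epsilon> \<eta>]]) auto
qed

text \<open>For each \<open>i \<noteq> j\<close> a field of \<open>W\<close> with the same
  \<open>i\<close>-th component is subtracted; the choice of \<open>j\<close> is arbitrary. What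
  remains is \<open>q \<partial>_j\<close> of divergence zero, so \<open>q\<close> does not involve
  \<open>x_j\<close> and the remainder is a sum of monomial fields in \<open>W\<close>.\<close>

lemma zero_div_W:
  assumes \<gg>: "\<gg> = Vec_zero_div" and \<delta>: "\<delta> \<in> \<gg>"
  shows "\<delta> \<in> W"
proof -
  obtain j :: 'n where True by simp
  have "\<exists>\<epsilon>. i \<noteq> j \<longrightarrow> \<epsilon> \<in> W \<and> \<epsilon> (var i) = \<delta> (var i) \<and> (\<forall>l. l \<noteq> i \<longrightarrow> l \<noteq> j \<longrightarrow> \<epsilon> (var l) = 0)" for i
    using two_component_field[of i j "\<delta> (var i)"] by blast
  then obtain \<epsilon> where \<epsilon>: "\<And>i. i \<noteq> j \<Longrightarrow> \<epsilon> i \<in> W" "\<And>i. i \<noteq> j \<Longrightarrow> \<epsilon> i (var i) = \<delta> (var i)"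
    "\<And>i l. i \<noteq> j \<Longrightarrow> l \<noteq> i \<Longrightarrow> l \<noteq> j \<Longrightarrow> \<epsilon> i (var l) = 0"
    by metis
  define S where "S p = (\<Sum>i\<in>UNIV - {j}. \<epsilon> i p)" for p
  have S: "S \<in> W"
    unfolding S_def by (intro W_sum \<epsilon>(1)) simp
  define \<eta> where "\<eta> p = \<delta> p + const (- 1) * S p" for p
  have \<eta>: "\<eta> \<in> \<gg>"
    unfolding \<eta>_def by (intro add_in \<delta> scale_in W_D(1)[OF S])
  have \<eta>_var: "\<eta> (var l) = 0" if "l \<noteq> j" for l
  proof -
    have "S (var l) = (\<Sum>i\<in>UNIV - {j}. if i = l then \<delta> (var l) else 0)"
      unfolding S_def using that by (intro sum.cong refl) (auto simp: \<epsilon>)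
    then show ?thesis using that by (simp add: \<eta>_def const_uminus)
  qed
  define q where "q = \<eta> (var j)"
  have \<eta>_eq: "\<eta> = fld q j"
    by (rule Vec_eqI[OF in_Vec[OF \<eta>] fld_in_Vec]) (auto simp: q_def \<eta>_var)
  then have "partial j q = 0"
    using \<eta> by (auto simp: \<gg> Vec_zero_div_def divergence_fld)
  have "Poly_Mapping.lookup m j = 0" if "m \<in> Poly_Mapping.keys q" for m
  proof (rule ccontr)
    assume "Poly_Mapping.lookup m j \<noteq> 0"
    then have "m - Poly_Mapping.single j 1 + Poly_Mapping.single j 1 = m"
      by (intro poly_mapping_eqI) (auto simp: lookup_add lookup_minus lookup_single when_def)
    then have "Poly_Mapping.lookup (partial j q) (m - Poly_Mapping.single j 1) \<noteq> 0"
      using that unfolding lookup_partial by (simp add: in_keys_iff del: of_nat_Suc)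
    then show False using \<open>partial j q = 0\<close> by simp
  qed
  then have "(\<lambda>p. \<Sum>m\<in>Poly_Mapping.keys q. fld (Poly_Mapping.single m (Poly_Mapping.lookup q m)) j p) \<in> W"
    by (intro W_sum monomial_fld_W)
  also have "(\<lambda>p. \<Sum>m\<in>Poly_Mapping.keys q. fld (Poly_Mapping.single m (Poly_Mapping.lookup q m)) j p) = fld q j"
    unfolding fld_def sum_distrib_right[symmetric] mpoly_expand[of q, symmetric] ..
  finally have "(\<lambda>p. \<eta> p + S p) \<in> W"
    unfolding \<eta>_eq by (intro W_add S)
  then show ?thesis
    by (simp add: \<eta>_def const_uminus)
qed

lemma W_eq: "W = \<gg>"
proof
  show "W \<subseteq> \<gg>" by (auto intro: W_D)
  show "\<gg> \<subseteq> W"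
  proof
    fix \<delta> assume "\<delta> \<in> \<gg>"
    moreover obtain N where "\<And>l. degree_less N (\<delta> (var l))"
      using ex_degree_less[of "\<lambda>l. \<delta> (var l)"] by blast
    ultimately show "\<delta> \<in> W"
      using W_if_degree_less zero_div_W by blast
  qed
qed

text \<open>The field \<open>\<theta> \<delta>\<close> has coefficients
  \<open>Y (\<delta> (var l))\<close> in the divergence-free frame \<open>D l\<close>, and
  \<open>D l\<close> corresponds to \<open>partial l\<close> under \<open>Y\<close>. The formula
  later yields the invariance of the smaller algebras under \<open>Ad\<close>.\<close>

lemma divergence_image:
  assumes "\<delta> \<in> \<gg>"
  shows "divergence (\<theta> \<delta>) = Y (divergence \<delta>)"
proof -
  have "\<theta> \<delta> = (\<lambda>p. \<Sum>l\<in>UNIV. Y (\<delta> (var l)) * D l p)"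
    using D_coordinates[OF dual image_in_Vec[OF assms]] W_y assms by (auto simp: W_eq)
  then have "divergence (\<theta> \<delta>) = (\<Sum>l\<in>UNIV. Y (partial l (\<delta> (var l))))"
    by (simp add: divergence_sum divergence_mult_left[OF D_Vec] D_divergence D_Y)
  then show ?thesis
    by (simp add: divergence_def Y_def comorphism_sum)
qed

end

text \<open>The substitution is not yet known to be invertible, so conjugation is expressed as an
  intertwining relation.\<close>

theorem lie_auto_conjugation:
  fixes \<gg> :: "('k::field_char_0, 'n::finite) operator set"
  assumes "vector_algebra \<gg>" "\<theta> \<in> lie_auto \<gg>"
  obtains y where
    "\<And>\<delta> f. \<delta> \<in> \<gg> \<Longrightarrow> \<theta> \<delta> (comorphism (poly_map y) f) = comorphism (poly_map y) (\<delta> f)"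
    "\<And>\<delta>. \<delta> \<in> \<gg> \<Longrightarrow> divergence (\<theta> \<delta>) = comorphism (poly_map y) (divergence \<delta>)"
proof -
  interpret vector_algebra_automorphism \<gg> \<theta>
    using assms by unfold_locales
  obtain a where a: "\<And>i. a i \<noteq> 0" "diag_field a \<in> \<gg>" "\<gg> \<noteq> Vec_zero_div \<Longrightarrow> a = (\<lambda>_. 1)"
    using diag_field_nonzero_weights[OF assms(1)] by blast
  obtain y where y: "\<And>k l. D k (y l) = (if k = l then 1 else 0)"
    "\<And>l. \<theta> (diag_field a) (y l) = const (a l) * y l"
    using dual_coordinates[OF a(1,2)] by blast
  interpret automorphism_coordinates \<gg> \<theta> a y
    using a y by unfold_locales auto
  show thesis
    using that[of y] W_D(2) divergence_image by (simp add: W_eq Y_def)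
qed

text \<open>Commuting with the coordinate derivations leaves only translations, and commuting with a
  diagonal field of nonzero weights rules out a nontrivial one.\<close>

lemma comorphism_commuting_imp_id:
  fixes \<gg> :: "('k::field_char_0, 'n::finite) operator set"
  assumes "vector_algebra \<gg>" and \<phi>: "polynomial_map \<phi>"
    and comm: "\<And>\<delta> f. \<delta> \<in> \<gg> \<Longrightarrow> \<delta> (comorphism \<phi> f) = comorphism \<phi> (\<delta> f)"
  shows "\<phi> = id"
proof (rule polynomial_map_eq_id[OF \<phi>])
  fix l
  obtain a where a: "\<And>i. a i \<noteq> 0" "diag_field a \<in> \<gg>" "\<gg> \<noteq> Vec_zero_div \<Longrightarrow> a = (\<lambda>_. 1)"
    using diag_field_nonzero_weights[OF assms(1)] by blast
  note hom = polynomial_map_comorphism[OF \<phi>] and h = VecD[OF diag_field_in_Vec]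
  let ?q = "comorphism \<phi> (var l)"
  have "partial k (?q - var l) = 0" for k
    using comm[of "partial k" "var l"] vector_algebra_subset(2)[OF assms(1)] partial_in_Vec_zero_div[of k]
    by (auto simp: partial_var hom)
  then obtain c where c: "?q - var l = const c"
    using partials_0_imp_const by blast
  have "diag_field a ?q = const (a l) * ?q"
    by (simp add: comm[OF a(2)] hom)
  moreover have "diag_field a (?q - var l) = 0"
    unfolding c by (rule h(6))
  ultimately have "const (a l) * (?q - var l) = 0"
    by (simp add: h(5) right_diff_distrib)
  then show "?q = var l"
    using a(1)[of l] by simp
qed

section \<open>The adjoint representation\<close>

lemma carrier_Aut_affine:
  "carrier Aut_affine = {\<phi>. bij \<phi> \<and> polynomial_map \<phi> \<and> polynomial_map (inv_into UNIV \<phi>)}"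
  by (simp add: Aut_affine_def)

lemma carrier_Aut_Lie: "carrier (Aut_Lie \<gg>) = lie_auto \<gg>"
  by (simp add: Aut_Lie_def)

lemma mult_Aut_affine:
  "\<phi> \<in> carrier Aut_affine \<Longrightarrow> \<psi> \<in> carrier Aut_affine \<Longrightarrow> \<phi> \<otimes>\<^bsub>Aut_affine\<^esub> \<psi> = \<phi> \<circ> \<psi>"
  by (auto simp: Aut_affine_def BijGroup_def Bij_def compose_def fun_eq_iff)

lemma mult_Aut_Lie:
  "\<theta> \<in> lie_auto \<gg> \<Longrightarrow> \<eta> \<in> lie_auto \<gg> \<Longrightarrow> \<theta> \<otimes>\<^bsub>Aut_Lie \<gg>\<^esub> \<eta> = compose \<gg> \<theta> \<eta>"
  by (simp add: Aut_Lie_def BijGroup_def lie_auto_def)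

lemma inv_Aut_affine:
  "\<phi> \<in> carrier Aut_affine \<Longrightarrow> inv_into UNIV \<phi> \<in> carrier Aut_affine"
  by (auto simp: carrier_Aut_affine bij_imp_bij_inv inv_inv_eq)

lemma comorphism_inv:
  fixes \<phi> :: "'k::field_char_0 ^ 'n::finite \<Rightarrow> 'k ^ 'n"
  assumes "\<phi> \<in> carrier Aut_affine"
  shows "comorphism \<phi> (comorphism (inv_into UNIV \<phi>) f) = f"
    and "comorphism (inv_into UNIV \<phi>) (comorphism \<phi> f) = f"
proof -
  have \<phi>: "bij \<phi>" "polynomial_map \<phi>" "polynomial_map (inv_into UNIV \<phi>)"
    using assms by (auto simp: carrier_Aut_affine)
  have "inv_into UNIV \<phi> \<circ> \<phi> = id" "\<phi> \<circ> inv_into UNIV \<phi> = id"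
    using \<phi>(1) by (auto simp: fun_eq_iff bij_is_inj bij_is_surj surj_f_inv_f)
  then show "comorphism \<phi> (comorphism (inv_into UNIV \<phi>) f) = f"
    "comorphism (inv_into UNIV \<phi>) (comorphism \<phi> f) = f"
    using comorphism_comp[OF \<phi>(3,2), of f] comorphism_comp[OF \<phi>(2,3), of f] by simp_all
qed

lemma Ad_eq:
  fixes \<phi> :: "'k::field_char_0 ^ 'n::finite \<Rightarrow> 'k ^ 'n"
  assumes "\<phi> \<in> carrier Aut_affine" "\<delta> \<in> Vec"
  shows "Ad \<phi> \<delta> = (\<lambda>f. comorphism (inv_into UNIV \<phi>) (\<delta> (comorphism \<phi> f)))"
proof -
  have "inv_into UNIV (comorphism \<phi>) = comorphism (inv_into UNIV \<phi>)"
    by (rule Hilbert_Choice.inv_equality) (simp_all add: comorphism_inv[OF assms(1)])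
  then show ?thesis
    using assms(2) by (simp add: Ad_def fun_eq_iff)
qed

lemma Ad_Vec:
  fixes \<phi> :: "'k::field_char_0 ^ 'n::finite \<Rightarrow> 'k ^ 'n"
  assumes \<phi>: "\<phi> \<in> carrier Aut_affine" and \<delta>: "\<delta> \<in> Vec"
  shows "Ad \<phi> \<delta> \<in> Vec"
proof -
  have "polynomial_map \<phi>" "polynomial_map (inv_into UNIV \<phi>)"
    using \<phi> by (auto simp: carrier_Aut_affine)
  note hom = polynomial_map_comorphism[OF this(1)] polynomial_map_comorphism[OF this(2)]
  show ?thesis
    unfolding Ad_eq[OF \<phi> \<delta>] by (rule Vec_I) (simp_all add: hom VecD[OF \<delta>] comorphism_inv[OF \<phi>])
qed

text \<open>Comorphisms reverse composition, and conjugation with the inverse on the left reverses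
  it once more.\<close>

lemma Ad_comp:
  fixes \<phi> \<psi> :: "'k::field_char_0 ^ 'n::finite \<Rightarrow> 'k ^ 'n"
  assumes \<phi>: "\<phi> \<in> carrier Aut_affine" and \<psi>: "\<psi> \<in> carrier Aut_affine" and \<delta>: "\<delta> \<in> Vec"
  shows "Ad (\<phi> \<circ> \<psi>) \<delta> = Ad \<phi> (Ad \<psi> \<delta>)"
proof -
  have \<phi>\<psi>: "\<phi> \<circ> \<psi> \<in> carrier Aut_affine"
    using group.is_monoid[OF group_Aut_affine] monoid.m_closed \<phi> \<psi> mult_Aut_affine by metis
  have m: "bij \<phi>" "bij \<psi>" "polynomial_map \<phi>" "polynomial_map \<psi>"
    "polynomial_map (inv_into UNIV \<phi>)" "polynomial_map (inv_into UNIV \<psi>)"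
    using \<phi> \<psi> by (auto simp: carrier_Aut_affine)
  show ?thesis
    unfolding Ad_eq[OF \<phi>\<psi> \<delta>] Ad_eq[OF \<phi> Ad_Vec[OF \<psi> \<delta>]]
    unfolding Ad_eq[OF \<psi> \<delta>]
    by (simp add: o_inv_distrib m comorphism_comp[OF m(3,4)] comorphism_comp[OF m(6,5)])
qed

lemma Ad_id:
  assumes "\<delta> \<in> (Vec :: ('k::field_char_0, 'n::finite) operator set)"
  shows "Ad id \<delta> = \<delta>"
  using assms by (simp add: Ad_def)

lemma Ad_inv:
  fixes \<phi> :: "'k::field_char_0 ^ 'n::finite \<Rightarrow> 'k ^ 'n"
  assumes \<phi>: "\<phi> \<in> carrier Aut_affine" and \<delta>: "\<delta> \<in> Vec"
  shows "Ad \<phi> (Ad (inv_into UNIV \<phi>) \<delta>) = \<delta>" "Ad (inv_into UNIV \<phi>) (Ad \<phi> \<delta>) = \<delta>"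
proof -
  have "inv_into UNIV \<phi> \<circ> \<phi> = id" "\<phi> \<circ> inv_into UNIV \<phi> = id"
    using \<phi> by (auto simp: carrier_Aut_affine fun_eq_iff bij_is_inj bij_is_surj surj_f_inv_f)
  then show "Ad \<phi> (Ad (inv_into UNIV \<phi>) \<delta>) = \<delta>" "Ad (inv_into UNIV \<phi>) (Ad \<phi> \<delta>) = \<delta>"
    using Ad_comp[OF \<phi> inv_Aut_affine[OF \<phi>] \<delta>] Ad_comp[OF inv_Aut_affine[OF \<phi>] \<phi> \<delta>] Ad_id[OF \<delta>]
    by simp_all
qed

text \<open>Invariance of \<open>\<gg>\<close> is a hypothesis because only the case
  \<open>Vec\<close> is immediate; that case is then used to obtain it for the others. It ranges
  over all \<open>\<psi>\<close> so as to cover the inverse of \<open>\<phi>\<close>.\<close>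

lemma restrict_Ad_lie_auto_if:
  fixes \<phi> :: "'k::field_char_0 ^ 'n::finite \<Rightarrow> 'k ^ 'n"
  assumes \<phi>: "\<phi> \<in> carrier Aut_affine" and \<gg>: "vector_algebra \<gg>"
    and closed: "\<And>\<psi> \<delta>. \<psi> \<in> carrier Aut_affine \<Longrightarrow> \<delta> \<in> \<gg> \<Longrightarrow> Ad \<psi> \<delta> \<in> \<gg>"
  shows "restrict (Ad \<phi>) \<gg> \<in> lie_auto \<gg>"
proof -
  have V: "\<delta> \<in> Vec" if "\<delta> \<in> \<gg>" for \<delta>
    using that vector_algebra_subset(1)[OF \<gg>] by blast
  have sub: "lie_subalgebra \<gg>" by (rule vector_algebra_lie_subalgebra[OF \<gg>])
  have "polynomial_map (inv_into UNIV \<phi>)"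
    using \<phi> by (auto simp: carrier_Aut_affine)
  note hom = polynomial_map_comorphism[OF this]
  have "bij_betw (restrict (Ad \<phi>) \<gg>) \<gg> \<gg>"
    by (rule bij_betw_byWitness[where f' = "Ad (inv_into UNIV \<phi>)"])
      (auto simp: closed \<phi> inv_Aut_affine Ad_inv V)
  then have "restrict (Ad \<phi>) \<gg> \<in> Bij \<gg>"
    by (simp add: Bij_def)
  then show ?thesis
    using sub unfolding lie_auto_def lie_subalgebra_def
    by (auto simp: Ad_eq[OF \<phi>] V)
      (auto simp: add_op_def scale_op_def lie_bracket_def hom comorphism_inv[OF \<phi>])
qed

text \<open>On \<open>Vec\<close>, \<open>Ad \<phi>\<close> is a Lie automorphism and therefore
  transforms divergences by a ring endomorphism that fixes constants. This replaces a computation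
  with the Jacobian determinant.\<close>

lemma Ad_closed:
  fixes \<phi> :: "'k::field_char_0 ^ 'n::finite \<Rightarrow> 'k ^ 'n"
  assumes \<phi>: "\<phi> \<in> carrier Aut_affine" and \<gg>: "vector_algebra \<gg>" and \<delta>: "\<delta> \<in> \<gg>"
  shows "Ad \<phi> \<delta> \<in> \<gg>"
proof -
  have alg: "vector_algebra (Vec :: ('k, 'n) operator set)"
    by (simp add: vector_algebra_def)
  have V: "\<delta> \<in> Vec"
    using \<delta> vector_algebra_subset(1)[OF \<gg>] by blast
  have "restrict (Ad \<phi>) Vec \<in> lie_auto Vec"
    by (rule restrict_Ad_lie_auto_if[OF \<phi> alg Ad_Vec])
  then obtain y where "divergence (restrict (Ad \<phi>) Vec \<delta>) = comorphism (poly_map y) (divergence \<delta>)"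
    using lie_auto_conjugation[OF alg] V by metis
  then have "divergence (Ad \<phi> \<delta>) = comorphism (poly_map y) (divergence \<delta>)"
    using V by simp
  then show ?thesis
    using \<gg> \<delta> Ad_Vec[OF \<phi> V]
    by (auto simp: vector_algebra_def Vec_const_div_def Vec_zero_div_def comorphism_const comorphism_0)
qed

lemma restrict_Ad_lie_auto:
  fixes \<phi> :: "'k::field_char_0 ^ 'n::finite \<Rightarrow> 'k ^ 'n"
  assumes "\<phi> \<in> carrier Aut_affine" "vector_algebra \<gg>"
  shows "restrict (Ad \<phi>) \<gg> \<in> lie_auto \<gg>"
  using assms Ad_closed by (intro restrict_Ad_lie_auto_if) auto

text \<open>Equality of the actions means that the comorphism of
  \<open>inv_into UNIV \<psi> \<circ> \<phi>\<close> commutes with all of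
  \<open>\<gg>\<close>.\<close>

lemma Ad_inject:
  fixes \<phi> \<psi> :: "'k::field_char_0 ^ 'n::finite \<Rightarrow> 'k ^ 'n"
  assumes \<phi>: "\<phi> \<in> carrier Aut_affine" and \<psi>: "\<psi> \<in> carrier Aut_affine" and \<gg>: "vector_algebra \<gg>"
    and eq: "\<And>\<delta>. \<delta> \<in> \<gg> \<Longrightarrow> Ad \<phi> \<delta> = Ad \<psi> \<delta>"
  shows "\<phi> = \<psi>"
proof -
  let ?\<psi>' = "inv_into UNIV \<psi>"
  have m: "polynomial_map \<phi>" "polynomial_map ?\<psi>'" "bij \<psi>"
    using \<phi> \<psi> by (auto simp: carrier_Aut_affine)
  have "?\<psi>' \<circ> \<phi> = id"
  proof (rule comorphism_commuting_imp_id[OF \<gg> polynomial_map_comp[OF m(2,1)]])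
    fix \<delta> f assume \<delta>: "\<delta> \<in> \<gg>"
    then have V: "\<delta> \<in> Vec"
      using vector_algebra_subset(1)[OF \<gg>] by blast
    have "comorphism (inv_into UNIV \<phi>) (\<delta> (comorphism \<phi> g)) = comorphism ?\<psi>' (\<delta> (comorphism \<psi> g))" for g
      using eq[OF \<delta>] unfolding Ad_eq[OF \<phi> V] Ad_eq[OF \<psi> V] by (rule fun_cong)
    from arg_cong[OF this[of "comorphism ?\<psi>' f"], of "comorphism \<phi>"]
    show "\<delta> (comorphism (?\<psi>' \<circ> \<phi>) f) = comorphism (?\<psi>' \<circ> \<phi>) (\<delta> f)"
      by (simp add: comorphism_comp[OF m(2,1)] comorphism_inv[OF \<phi>] comorphism_inv[OF \<psi>])
  qed
  then have "\<psi> (?\<psi>' (\<phi> x)) = \<psi> x" for x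
    by (simp add: fun_eq_iff)
  then show ?thesis
    using m(3) by (simp add: fun_eq_iff bij_is_surj surj_f_inv_f)
qed

section \<open>Every Lie automorphism is a restriction of \<open>Ad\<close>\<close>

lemma lie_auto_inv:
  assumes \<gg>: "lie_subalgebra \<gg>" and \<theta>: "\<theta> \<in> lie_auto \<gg>"
  obtains \<eta> where "\<eta> \<in> lie_auto \<gg>" "\<And>\<delta>. \<delta> \<in> \<gg> \<Longrightarrow> \<theta> (\<eta> \<delta>) = \<delta>" "\<And>\<delta>. \<delta> \<in> \<gg> \<Longrightarrow> \<eta> (\<theta> \<delta>) = \<delta>"
proof -
  interpret G: group "Aut_Lie \<gg>" by (rule group_Aut_Lie[OF \<gg>])
  let ?\<eta> = "inv\<^bsub>Aut_Lie \<gg>\<^esub> \<theta>"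
  have \<theta>': "\<theta> \<in> carrier (Aut_Lie \<gg>)" using \<theta> by (simp add: carrier_Aut_Lie)
  have \<eta>: "?\<eta> \<in> lie_auto \<gg>"
    using G.inv_closed[OF \<theta>'] by (simp add: carrier_Aut_Lie)
  have one: "\<one>\<^bsub>Aut_Lie \<gg>\<^esub> = (\<lambda>\<delta>\<in>\<gg>. \<delta>)"
    by (simp add: Aut_Lie_def BijGroup_def)
  have "compose \<gg> \<theta> ?\<eta> = (\<lambda>\<delta>\<in>\<gg>. \<delta>)" "compose \<gg> ?\<eta> \<theta> = (\<lambda>\<delta>\<in>\<gg>. \<delta>)"
    using G.r_inv[OF \<theta>'] G.l_inv[OF \<theta>'] by (simp_all add: mult_Aut_Lie \<theta> \<eta> one)
  then have "\<theta> (?\<eta> \<delta>) = \<delta>" "?\<eta> (\<theta> \<delta>) = \<delta>" if "\<delta> \<in> \<gg>" for \<delta>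
    using that by (auto simp: compose_def dest: fun_cong[where x = \<delta>])
  with \<eta> show thesis by (rule that)
qed

lemma lie_auto_eq_Ad:
  fixes \<gg> :: "('k::field_char_0, 'n::finite) operator set"
  assumes \<gg>: "vector_algebra \<gg>" and \<theta>: "\<theta> \<in> lie_auto \<gg>"
  obtains \<phi> where "\<phi> \<in> carrier Aut_affine" "restrict (Ad \<phi>) \<gg> = \<theta>"
proof -
  obtain \<eta> where \<eta>: "\<eta> \<in> lie_auto \<gg>" and inv: "\<And>\<delta>. \<delta> \<in> \<gg> \<Longrightarrow> \<theta> (\<eta> \<delta>) = \<delta>" "\<And>\<delta>. \<delta> \<in> \<gg> \<Longrightarrow> \<eta> (\<theta> \<delta>) = \<delta>"
    using lie_auto_inv[OF vector_algebra_lie_subalgebra[OF \<gg>] \<theta>] by blast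
  have mem: "\<theta> \<delta> \<in> \<gg>" "\<eta> \<delta> \<in> \<gg>" if "\<delta> \<in> \<gg>" for \<delta>
    using that \<theta> \<eta> by (auto simp: lie_auto_def Bij_def dest: bij_betwE)
  obtain y where y: "\<And>\<delta> f. \<delta> \<in> \<gg> \<Longrightarrow> \<theta> \<delta> (comorphism (poly_map y) f) = comorphism (poly_map y) (\<delta> f)"
    using lie_auto_conjugation[OF \<gg> \<theta>] by metis
  obtain z where z: "\<And>\<delta> f. \<delta> \<in> \<gg> \<Longrightarrow> \<eta> \<delta> (comorphism (poly_map z) f) = comorphism (poly_map z) (\<delta> f)"
    using lie_auto_conjugation[OF \<gg> \<eta>] by metis
  \<comment> \<open>As \<open>Ad\<close> has the inverse comorphism on the left, the map inducing
    \<open>\<theta>\<close> is built from the coordinates \<open>z\<close> of the inverse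
    automorphism.\<close>
  let ?\<psi> = "poly_map y" and ?\<phi> = "poly_map z"
  have id: "?\<phi> \<circ> ?\<psi> = id" "?\<psi> \<circ> ?\<phi> = id"
  proof (rule_tac [!] comorphism_commuting_imp_id[OF \<gg> polynomial_map_comp])
    fix \<delta> f assume \<delta>: "\<delta> \<in> \<gg>"
    show "\<delta> (comorphism (?\<phi> \<circ> ?\<psi>) f) = comorphism (?\<phi> \<circ> ?\<psi>) (\<delta> f)"
      using y[OF mem(2)[OF \<delta>]] z[OF \<delta>] by (simp add: comorphism_comp inv(1)[OF \<delta>])
    show "\<delta> (comorphism (?\<psi> \<circ> ?\<phi>) f) = comorphism (?\<psi> \<circ> ?\<phi>) (\<delta> f)"
      using z[OF mem(1)[OF \<delta>]] y[OF \<delta>] by (simp add: comorphism_comp inv(2)[OF \<delta>])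
  qed simp_all
  have inv_\<phi>: "inv_into UNIV ?\<phi> = ?\<psi>"
    by (rule Hilbert_Choice.inv_equality) (use id in \<open>simp_all add: fun_eq_iff\<close>)
  have \<phi>: "?\<phi> \<in> carrier Aut_affine"
    using id by (auto simp: carrier_Aut_affine inv_\<phi> intro: o_bij)
  moreover have "Ad ?\<phi> \<delta> = \<theta> \<delta>" if \<delta>: "\<delta> \<in> \<gg>" for \<delta>
  proof
    fix f
    have V: "\<delta> \<in> Vec" using \<delta> vector_algebra_subset(1)[OF \<gg>] by blast
    have "Ad ?\<phi> \<delta> f = \<theta> \<delta> (comorphism ?\<psi> (comorphism ?\<phi> f))"
      unfolding Ad_eq[OF \<phi> V] inv_\<phi> y[OF \<delta>] ..
    then show "Ad ?\<phi> \<delta> f = \<theta> \<delta> f"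
      using comorphism_inv(2)[OF \<phi>, of f] by (simp add: inv_\<phi>)
  qed
  then have "restrict (Ad ?\<phi>) \<gg> = \<theta>"
    using \<theta> by (intro extensionalityI[of _ \<gg>]) (auto simp: lie_auto_def Bij_def)
  ultimately show thesis by (rule that)
qed

section \<open>The isomorphisms of groups\<close>

lemma restrict_Ad_iso:
  fixes \<gg> :: "('k::field_char_0, 'n::finite) operator set"
  assumes \<gg>: "vector_algebra \<gg>"
  shows "(\<lambda>\<phi>. restrict (Ad \<phi>) \<gg>) \<in> iso Aut_affine (Aut_Lie \<gg>)"
proof (rule isoI)
  have V: "\<delta> \<in> Vec" if "\<delta> \<in> \<gg>" for \<delta>
    using that vector_algebra_subset(1)[OF \<gg>] by blast
  show "(\<lambda>\<phi>. restrict (Ad \<phi>) \<gg>) \<in> hom Aut_affine (Aut_Lie \<gg>)"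
  proof (rule homI)
    fix \<phi> \<psi> :: "'k ^ 'n \<Rightarrow> 'k ^ 'n"
    assume *: "\<phi> \<in> carrier Aut_affine" "\<psi> \<in> carrier Aut_affine"
    have "restrict (Ad (\<phi> \<circ> \<psi>)) \<gg> = compose \<gg> (restrict (Ad \<phi>) \<gg>) (restrict (Ad \<psi>) \<gg>)"
      by (auto simp: compose_def Ad_comp[OF * V] Ad_closed[OF *(2) \<gg>])
    then show "restrict (Ad (\<phi> \<otimes>\<^bsub>Aut_affine\<^esub> \<psi>)) \<gg>
        = restrict (Ad \<phi>) \<gg> \<otimes>\<^bsub>Aut_Lie \<gg>\<^esub> restrict (Ad \<psi>) \<gg>"
      by (simp add: mult_Aut_affine[OF *] mult_Aut_Lie restrict_Ad_lie_auto * \<gg>)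
  qed (simp add: carrier_Aut_Lie restrict_Ad_lie_auto \<gg>)
  show "bij_betw (\<lambda>\<phi>. restrict (Ad \<phi>) \<gg>) (carrier Aut_affine) (carrier (Aut_Lie \<gg>))"
    unfolding bij_betw_def carrier_Aut_Lie
  proof (intro conjI inj_onI)
    fix \<phi> \<psi> :: "'k ^ 'n \<Rightarrow> 'k ^ 'n"
    assume *: "\<phi> \<in> carrier Aut_affine" "\<psi> \<in> carrier Aut_affine"
      and eq: "restrict (Ad \<phi>) \<gg> = restrict (Ad \<psi>) \<gg>"
    show "\<phi> = \<psi>"
      by (rule Ad_inject[OF * \<gg>]) (use eq in \<open>metis restrict_apply'\<close>)
  next
    show "(\<lambda>\<phi>. restrict (Ad \<phi>) \<gg>) ` carrier Aut_affine = lie_auto \<gg>"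
    proof
      show "lie_auto \<gg> \<subseteq> (\<lambda>\<phi>. restrict (Ad \<phi>) \<gg>) ` carrier Aut_affine"
        using lie_auto_eq_Ad[OF \<gg>] by blast
    qed (auto simp: restrict_Ad_lie_auto \<gg>)
  qed
qed

text \<open>Restriction turns \<open>Ad\<close> on \<open>\<gg>\<close> into \<open>Ad\<close> on
  \<open>\<hh>\<close>, and both are isomorphisms from \<open>Aut_affine\<close>. That restricted
  automorphisms preserve \<open>\<hh>\<close> also follows, since each of them comes from
  \<open>Ad\<close>.\<close>

lemma restriction_iso:
  fixes \<gg> \<hh> :: "('k::field_char_0, 'n::finite) operator set"
  assumes \<gg>: "vector_algebra \<gg>" and \<hh>: "vector_algebra \<hh>" and sub: "\<hh> \<subseteq> \<gg>"
  shows "(\<lambda>\<theta>. restrict \<theta> \<hh>) \<in> iso (Aut_Lie \<gg>) (Aut_Lie \<hh>)"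
proof (rule isoI)
  let ?A = "\<lambda>\<gg> \<phi>. restrict (Ad \<phi>) \<gg>" and ?r = "\<lambda>\<theta>. restrict \<theta> \<hh>"
  have r: "?r (?A \<gg> \<phi>) = ?A \<hh> \<phi>" for \<phi> :: "'k ^ 'n \<Rightarrow> 'k ^ 'n"
    using sub by (auto simp: restrict_def fun_eq_iff)
  note iso = restrict_Ad_iso[OF \<gg>] restrict_Ad_iso[OF \<hh>]
  have hom: "?A \<gg> \<in> hom Aut_affine (Aut_Lie \<gg>)" "?A \<hh> \<in> hom Aut_affine (Aut_Lie \<hh>)"
    and bij: "bij_betw (?A \<gg>) (carrier Aut_affine) (carrier (Aut_Lie \<gg>))"
      "bij_betw (?A \<hh>) (carrier Aut_affine) (carrier (Aut_Lie \<hh>))"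
    using iso by (simp_all add: iso_def)
  have surj: "\<exists>\<phi>\<in>carrier Aut_affine. \<theta> = ?A \<gg> \<phi>" if "\<theta> \<in> carrier (Aut_Lie \<gg>)" for \<theta>
    using that bij(1) by (auto simp: bij_betw_def)
  show "?r \<in> hom (Aut_Lie \<gg>) (Aut_Lie \<hh>)"
  proof (rule homI)
    fix \<theta> assume "\<theta> \<in> carrier (Aut_Lie \<gg>)"
    then show "?r \<theta> \<in> carrier (Aut_Lie \<hh>)"
      using surj r hom_in_carrier[OF hom(2)] by metis
  next
    fix \<theta> \<eta> assume "\<theta> \<in> carrier (Aut_Lie \<gg>)" "\<eta> \<in> carrier (Aut_Lie \<gg>)"
    then obtain \<phi> \<psi> where *: "\<phi> \<in> carrier Aut_affine" "\<psi> \<in> carrier Aut_affine"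
      "\<theta> = ?A \<gg> \<phi>" "\<eta> = ?A \<gg> \<psi>"
      using surj by metis
    show "?r (\<theta> \<otimes>\<^bsub>Aut_Lie \<gg>\<^esub> \<eta>) = ?r \<theta> \<otimes>\<^bsub>Aut_Lie \<hh>\<^esub> ?r \<eta>"
      unfolding *(3,4) r hom_mult[OF hom(1) *(1,2), symmetric] hom_mult[OF hom(2) *(1,2), symmetric] ..
  qed
  have "bij_betw (?r \<circ> ?A \<gg>) (carrier Aut_affine) (carrier (Aut_Lie \<hh>))"
    unfolding comp_def r by (rule bij(2))
  then show "bij_betw ?r (carrier (Aut_Lie \<gg>)) (carrier (Aut_Lie \<hh>))"
    using bij_betw_comp_iff[OF bij(1)] by blast
qed

theorem mainTheorem1:
  shows "Ad \<in> iso Aut_affine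
           (Aut_Lie (Vec :: ('k::{alg_closed_field, field_char_0}, 'n::finite) operator set)) \<and>
         (\<lambda>\<theta>. restrict \<theta> Vec_const_div) \<in> iso
           (Aut_Lie (Vec :: ('k, 'n) operator set)) (Aut_Lie Vec_const_div) \<and>
         (CARD('n) \<ge> 2 \<longrightarrow>
          (\<lambda>\<theta>. restrict \<theta> Vec_zero_div) \<in> iso
            (Aut_Lie (Vec_const_div :: ('k, 'n) operator set)) (Aut_Lie Vec_zero_div))"
proof -
  have "restrict (Ad \<phi>) Vec = Ad \<phi>" for \<phi> :: "'k ^ 'n \<Rightarrow> 'k ^ 'n"
    by (simp add: Ad_def)
  then have "Ad \<in> iso Aut_affine (Aut_Lie (Vec :: ('k, 'n) operator set))"
    using restrict_Ad_iso[of "Vec :: ('k, 'n) operator set"] by (simp add: vector_algebra_def)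
  then show ?thesis
    by (auto intro!: restriction_iso Vec_zero_div_subset simp: vector_algebra_def)
qed

end
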